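(* For all $n\ge 1$ and $i\in\{0,1,\dots,n-1\}$, $$\mu_{\Pi_{n}^{w}}(\hat{0},[n]^{i})=(-1)^{n-1}|\mathcal T_{n,i}|,$$ where $\mu_{\Pi_n^w}$ is the Möbius function of the poset $\Pi_n^w$ of weighted partitions of $\{1,\dots,n\}$ and $\mathcal T_{n,i}$ is the set of rooted trees on node set $\{1,\dots,n\}$ with exactly $i$ descents.
   Context: Let $[n]=\{1,\dots,n\}$. A weighted partition of $[n]$ is a set $\{B_1^{v_1},\dots,B_t^{v_t}\}$ where $\{B_1,\dots,B_t\}$ is a partition of $[n]$ and $v_i\in\{0,1,\dots,|B_i|-1\}$ for all $i$. The poset $\Pi_n^w$ is the set of weighted partitions of $[n]$ ordered by: $\{A_1^{w_1},\dots,A_s^{w_s}\}\le\{B_1^{v_1},\dots,B_t^{v_t}\}$ iff (a) $\{A_1,\dots,A_s\}$ refines $\{B_1,\dots,B_t\}$, and (b) whenever $B_k=A_{i_1}\cup\cdots\cup A_{i_l}$, then $v_k-(w_{i_1}+\cdots+w_{i_l})\in\{0,1,\dots,l-1\}$. Its minimum element is $\hat 0=\{\{1\}^0,\dots,\{n\}^0\}$, and its maximal elements are the one-block weighted partitions $\{[n]^i\}$, $0\le i\le n-1$, written $[n]^i$. A descent of a rooted tree $T$ on node set $[n]$ is a non-root node whose label is smaller than the label of its parent. *)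

theory Defs
  imports "HOL-Library.Disjoint_Sets"
begin

section \<open>The Moebius function of a locally finite poset\<close>

text \<open>A poset is given by its order relation, a set of pairs as in \<^theory>\<open>HOL.Order_Relation\<close>.\<close>

definition locally_finite_poset :: "'a rel \<Rightarrow> bool" where
  "locally_finite_poset r \<longleftrightarrow>
     partial_order_on (Field r) r \<and> (\<forall>x y. finite {z. (x, z) \<in> r \<and> (z, y) \<in> r})"

text \<open>The guard \<^const>\<open>locally_finite_poset\<close> only serves to make the recursion terminate;
  it is discharged for the poset of weighted partitions below.\<close>

function moebius :: "'a rel \<Rightarrow> 'a \<Rightarrow> 'a \<Rightarrow> int" where
  "moebius r x y =
     (if x = y then 1
      else if locally_finite_poset r \<and> (x, y) \<in> r
      then - (\<Sum>z\<in>{z. (x, z) \<in> r \<and> (z, y) \<in> r \<and> z \<noteq> y}. moebius r x z)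
      else 0)"
  by pat_completeness auto
termination
proof (relation "measure (\<lambda>(r, x, y). card {w. (x, w) \<in> r \<and> (w, y) \<in> r})")
  fix r :: "'a rel" and x y z
  assume 1: "locally_finite_poset r \<and> (x, y) \<in> r"
    and 2: "z \<in> {z. (x, z) \<in> r \<and> (z, y) \<in> r \<and> z \<noteq> y}"
  have tr: "trans r" and as: "antisym r" and re: "refl_on (Field r) r"
    using 1 by (auto simp: locally_finite_poset_def partial_order_on_def preorder_on_def)
  have "y \<in> Field r"
    using 1 by (auto simp: Field_def)
  then have "(y, y) \<in> r"
    using re by (auto simp: refl_on_def)
  then have "{w. (x, w) \<in> r \<and> (w, z) \<in> r} \<subset> {w. (x, w) \<in> r \<and> (w, y) \<in> r}"
    using 1 2 tr as by (auto dest: transD antisymD)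
  then show "((r, x, z), (r, x, y)) \<in> measure (\<lambda>(r, x, y). card {w. (x, w) \<in> r \<and> (w, y) \<in> r})"
    using 1 by (auto simp: locally_finite_poset_def intro!: psubset_card_mono)
qed auto

declare moebius.simps [simp del]

section \<open>Weighted partitions\<close>

text \<open>A block \<open>B\<close> of weight \<open>v\<close> is the pair \<open>(B, v)\<close>.  Injectivity of \<^const>\<open>fst\<close> says that
  each block carries only one weight.\<close>

definition weighted_partitions :: "nat \<Rightarrow> (nat set \<times> nat) set set" where
  "weighted_partitions n =
     {P. partition_on {1..n} (fst ` P) \<and> inj_on fst P \<and> (\<forall>(B, v)\<in>P. v \<in> {0..card B - 1})}"

definition wp_le :: "nat \<Rightarrow> (nat set \<times> nat) set \<Rightarrow> (nat set \<times> nat) set \<Rightarrow> bool" where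
  "wp_le n P Q \<longleftrightarrow>
     refines {1..n} (fst ` P) (fst ` Q) \<and>
     (\<forall>(B, v)\<in>Q. \<forall>S\<subseteq>P. B = \<Union>(fst ` S) \<longrightarrow>
        int v - (\<Sum>(A, w)\<in>S. int w) \<in> {0..int (card S) - 1})"

definition weighted_partition_poset :: "nat \<Rightarrow> (nat set \<times> nat) set rel" where
  "weighted_partition_poset n =
     {(P, Q). P \<in> weighted_partitions n \<and> Q \<in> weighted_partitions n \<and> wp_le n P Q}"

definition wp_bottom :: "nat \<Rightarrow> (nat set \<times> nat) set" where
  "wp_bottom n = (\<lambda>k. ({k}, 0)) ` {1..n}"

definition wp_top :: "nat \<Rightarrow> nat \<Rightarrow> (nat set \<times> nat) set" where
  "wp_top n i = {({1..n}, i)}"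

lemma finite_weighted_partitions: "finite (weighted_partitions n)"
proof (rule finite_subset)
  show "weighted_partitions n \<subseteq> Pow (Pow {1..n} \<times> {0..n})"
  proof (intro subsetI PowI)
    fix P b assume P: "P \<in> weighted_partitions n" and b: "b \<in> P"
    obtain B v where [simp]: "b = (B, v)" by (cases b)
    have "B \<in> fst ` P"
      using b by force
    then have "B \<subseteq> {1..n}"
      using P by (auto simp: weighted_partitions_def partition_on_def)
    moreover from this have "card B \<le> n"
      using card_mono[of "{1..n}" B] by simp
    moreover have "v \<le> card B - 1"
      using P b by (auto simp: weighted_partitions_def)
    ultimately show "b \<in> Pow {1..n} \<times> {0..n}"
      by auto
  qed
qed simp

lemma wp_block_nonempty: "P \<in> weighted_partitions n \<Longrightarrow> b \<in> P \<Longrightarrow> fst b \<noteq> {}"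
  by (auto simp: weighted_partitions_def partition_on_def)

lemma wp_block_eq:
  assumes "P \<in> weighted_partitions n" "b \<in> P" "c \<in> P" "x \<in> fst b" "x \<in> fst c"
  shows "b = c"
proof -
  have "fst b = fst c"
    using assms by (force simp: weighted_partitions_def partition_on_def disjoint_def)
  then show ?thesis
    using assms by (auto simp: weighted_partitions_def dest: inj_onD)
qed

lemma finite_weighted_partition: "P \<in> weighted_partitions n \<Longrightarrow> finite P"
  using finite_elements[of "{1..n}" "fst ` P"] finite_imageD[of fst P]
  by (simp add: weighted_partitions_def)

lemma wp_sub_eq:
  assumes "P \<in> weighted_partitions n" "S \<subseteq> P" "b \<in> P" "\<Union>(fst ` S) = fst b"
  shows "S = {b}"
proof -
  have "c = b" if "c \<in> S" for c
    using wp_block_eq[OF assms(1), of c b] wp_block_nonempty[OF assms(1), of c] assms that by blast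
  moreover have "S \<noteq> {}"
    using assms wp_block_nonempty[of P n b] by auto
  ultimately show ?thesis by blast
qed

lemma wp_le_refl: "P \<in> weighted_partitions n \<Longrightarrow> wp_le n P P"
  unfolding wp_le_def
proof (intro conjI ballI)
  assume P: "P \<in> weighted_partitions n"
  then show "refines {1..n} (fst ` P) (fst ` P)"
    by (auto simp: weighted_partitions_def intro: refines_refl)
  fix b assume b: "b \<in> P"
  have "int (snd b) - (\<Sum>a\<in>S. int (snd a)) \<in> {0..int (card S) - 1}"
    if "S \<subseteq> P" "fst b = \<Union>(fst ` S)" for S
  proof -
    have "S = {b}"
      using wp_sub_eq[OF P that(1) b] that(2) by simp
    then show ?thesis by simp
  qed
  then show "case b of (B, v) \<Rightarrow> \<forall>S\<subseteq>P. B = \<Union>(fst ` S) \<longrightarrow>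
        int v - (\<Sum>(A, w)\<in>S. int w) \<in> {0..int (card S) - 1}"
    by (simp add: case_prod_unfold)
qed

lemma wp_le_antisym:
  assumes P: "P \<in> weighted_partitions n" and Q: "Q \<in> weighted_partitions n"
    and le: "wp_le n P Q" "wp_le n Q P"
  shows "P = Q"
proof -
  have fst: "fst ` P = fst ` Q"
    using le refines_asym unfolding wp_le_def by metis
  have sub: "X \<subseteq> Y" if X: "X \<in> weighted_partitions n" and Y: "Y \<in> weighted_partitions n"
    and XY: "wp_le n X Y" "wp_le n Y X" and f: "fst ` X = fst ` Y" for X Y
  proof
    fix b assume b: "b \<in> X"
    then obtain c where c: "c \<in> Y" "fst c = fst b"
      using f by (metis image_iff)
    have w: "int (snd d) - int (snd a) \<ge> 0"
      if "wp_le n A D" "a \<in> A" "d \<in> D" "fst a = fst d" for a d A D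
    proof -
      have "case d of (B, v) \<Rightarrow> \<forall>S\<subseteq>A. B = \<Union>(fst ` S) \<longrightarrow>
        int v - (\<Sum>(A, w)\<in>S. int w) \<in> {0..int (card S) - 1}"
        using that unfolding wp_le_def by blast
      then have "{a} \<subseteq> A \<longrightarrow> fst d = \<Union>(fst ` {a}) \<longrightarrow>
        int (snd d) - (\<Sum>a\<in>{a}. int (snd a)) \<in> {0..int (card {a}) - 1}"
        unfolding case_prod_unfold by blast
      then show ?thesis
        using that by simp
    qed
    have "int (snd b) - int (snd c) \<ge> 0" "int (snd c) - int (snd b) \<ge> 0"
      using w[of Y X c b] w[of X Y b c] XY b c by auto
    then have "b = c"
      using c by (auto simp: prod_eq_iff)
    then show "b \<in> Y"
      using c by simp
  qed
  show ?thesis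
    using sub[of P Q] sub[of Q P] assms fst by blast
qed

lemma wp_le_trans:
  assumes P: "P \<in> weighted_partitions n" and Q: "Q \<in> weighted_partitions n"
    and PQ: "wp_le n P Q" and QR: "wp_le n Q R"
  shows "wp_le n P R"
proof -
  have ref: "refines {1..n} (fst ` P) (fst ` Q)" "refines {1..n} (fst ` Q) (fst ` R)"
    using PQ QR by (auto simp: wp_le_def)
  have main: "int u - (\<Sum>a\<in>S. int (snd a)) \<in> {0..int (card S) - 1}"
    if C: "(C, u) \<in> R" and S: "S \<subseteq> P" "C = \<Union>(fst ` S)" for C u S
  proof -
    define T where "T = {b \<in> Q. fst b \<subseteq> C}"
    define F where "F = (\<lambda>b :: nat set \<times> nat. {a \<in> P. fst a \<subseteq> fst b})"
    have finP: "finite P" and finQ: "finite Q"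
      using P Q finite_weighted_partition by auto
    have finT: "finite T" and finF: "finite (F b)" for b
      using finP finQ by (auto simp: T_def F_def)
    have "partition_on C {p \<in> fst ` Q. p \<subseteq> C}"
      using refines_obtains_subset[OF ref(2), of C] C by force
    moreover have "{p \<in> fst ` Q. p \<subseteq> C} = fst ` T"
      by (auto simp: T_def)
    ultimately have UT: "C = \<Union>(fst ` T)"
      by (simp add: partition_on_def)
    have UF: "fst b = \<Union>(fst ` F b)" if "b \<in> Q" for b
    proof -
      have "partition_on (fst b) {p \<in> fst ` P. p \<subseteq> fst b}"
        using refines_obtains_subset[OF ref(1), of "fst b"] that by force
      moreover have "{p \<in> fst ` P. p \<subseteq> fst b} = fst ` F b"
        by (auto simp: F_def)
      ultimately show ?thesis
        by (simp add: partition_on_def)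
    qed
    have SF: "S = (\<Union>b\<in>T. F b)"
    proof (intro equalityI subsetI)
      fix a assume a: "a \<in> S"
      then have "fst a \<in> fst ` P" using S by auto
      then obtain b where b: "b \<in> Q" "fst a \<subseteq> fst b"
        using ref(1) unfolding refines_def by force
      obtain x where x: "x \<in> fst a"
        using a S(1) wp_block_nonempty[OF P] by blast
      then have "x \<in> \<Union>(fst ` T)"
        using a S(2) UT by auto
      then obtain b' where "b' \<in> T" "x \<in> fst b'" by auto
      then have "b = b'"
        using wp_block_eq[OF Q, of b b' x] b x by (auto simp: T_def)
      then show "a \<in> (\<Union>b\<in>T. F b)"
        using \<open>b' \<in> T\<close> b a S(1) by (auto simp: F_def)
    next
      fix a assume "a \<in> (\<Union>b\<in>T. F b)"
      then have a: "a \<in> P" "fst a \<subseteq> C" by (auto simp: F_def T_def)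
      obtain x where x: "x \<in> fst a"
        using a wp_block_nonempty[OF P] by blast
      then obtain a' where "a' \<in> S" "x \<in> fst a'"
        using a S(2) by auto
      then show "a \<in> S"
        using wp_block_eq[OF P, of a a' x] a x S(1) by auto
    qed
    have disj: "F b \<inter> F c = {}" if "b \<in> T" "c \<in> T" "b \<noteq> c" for b c
    proof (rule ccontr)
      assume "F b \<inter> F c \<noteq> {}"
      then obtain a where a: "a \<in> P" "fst a \<subseteq> fst b" "fst a \<subseteq> fst c"
        by (auto simp: F_def)
      then obtain x where "x \<in> fst a"
        using wp_block_nonempty[OF P] by blast
      then show False
        using wp_block_eq[OF Q, of b c x] a that by (auto simp: T_def)
    qed
    have sumS: "(\<Sum>a\<in>S. int (snd a)) = (\<Sum>b\<in>T. \<Sum>a\<in>F b. int (snd a))"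
      unfolding SF using finT finF disj by (intro sum.UNION_disjoint) auto
    have cardS: "int (card S) = (\<Sum>b\<in>T. int (card (F b)))"
      unfolding SF using finT finF disj by (subst card_UN_disjoint) auto
    have 1: "int (snd b) - (\<Sum>a\<in>F b. int (snd a)) \<in> {0..int (card (F b)) - 1}" if "b \<in> T" for b
    proof -
      have "b \<in> Q" using that by (simp add: T_def)
      moreover have "F b \<subseteq> P" by (auto simp: F_def)
      ultimately show ?thesis
        using PQ UF[of b] unfolding wp_le_def by (cases b) (auto simp: case_prod_unfold)
    qed
    have "T \<subseteq> Q" by (auto simp: T_def)
    then have 2: "int u - (\<Sum>b\<in>T. int (snd b)) \<in> {0..int (card T) - 1}"
      using QR C UT unfolding wp_le_def by (auto simp: case_prod_unfold)
    have "(\<Sum>b\<in>T. \<Sum>a\<in>F b. int (snd a)) \<le> (\<Sum>b\<in>T. int (snd b))"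
      using 1 by (intro sum_mono) fastforce
    moreover have "(\<Sum>b\<in>T. int (snd b))
        \<le> (\<Sum>b\<in>T. (\<Sum>a\<in>F b. int (snd a)) + (int (card (F b)) - 1))"
      using 1 by (intro sum_mono) fastforce
    ultimately show ?thesis
      using 2 by (simp add: sumS cardS sum.distrib sum_subtractf)
  qed
  show ?thesis
    unfolding wp_le_def using main refines_trans[OF ref] by (auto simp: case_prod_unfold)
qed

lemma partial_order_on_weighted_partition_poset:
  "partial_order_on (weighted_partitions n) (weighted_partition_poset n)"
  unfolding partial_order_on_def preorder_on_def
proof (intro conjI)
  show "weighted_partition_poset n \<subseteq> weighted_partitions n \<times> weighted_partitions n"
    by (auto simp: weighted_partition_poset_def)
  show "refl_on (weighted_partitions n) (weighted_partition_poset n)"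
    by (auto simp: weighted_partition_poset_def refl_on_def wp_le_refl)
  show "trans (weighted_partition_poset n)"
    unfolding weighted_partition_poset_def trans_def using wp_le_trans by blast
  show "antisym (weighted_partition_poset n)"
    unfolding weighted_partition_poset_def antisym_def using wp_le_antisym by blast
qed

lemma locally_finite_weighted_partition_poset:
  "locally_finite_poset (weighted_partition_poset n)"
  unfolding locally_finite_poset_def
proof (intro conjI allI)
  have "Field (weighted_partition_poset n) = weighted_partitions n"
  proof (intro equalityI subsetI)
    fix P assume "P \<in> weighted_partitions n"
    then have "(P, P) \<in> weighted_partition_poset n"
      using wp_le_refl by (simp add: weighted_partition_poset_def)
    then show "P \<in> Field (weighted_partition_poset n)"
      by (rule FieldI1)
  next
    fix P assume "P \<in> Field (weighted_partition_poset n)"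
    then show "P \<in> weighted_partitions n"
      unfolding weighted_partition_poset_def Field_def by (elim UnE DomainE RangeE) simp_all
  qed
  then show "partial_order_on (Field (weighted_partition_poset n)) (weighted_partition_poset n)"
    using partial_order_on_weighted_partition_poset by simp
  show "finite {z. (x, z) \<in> weighted_partition_poset n \<and> (z, y) \<in> weighted_partition_poset n}" for x y
    by (rule finite_subset[OF _ finite_weighted_partitions[of n]])
      (auto simp: weighted_partition_poset_def)
qed

section \<open>Rooted trees and descents\<close>

text \<open>Simple graphs are given by a vertex set \<open>V\<close> and a set \<open>E\<close> of two-element edges;
  paths are lists of distinct vertices.\<close>

definition is_path :: "'a set \<Rightarrow> 'a set set \<Rightarrow> 'a list \<Rightarrow> bool" where
  "is_path V E p \<longleftrightarrow>
     p \<noteq> [] \<and> set p \<subseteq> V \<and> distinct p \<and> successively (\<lambda>x y. {x, y} \<in> E) p"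

definition is_cycle :: "'a set \<Rightarrow> 'a set set \<Rightarrow> 'a list \<Rightarrow> bool" where
  "is_cycle V E p \<longleftrightarrow> is_path V E p \<and> length p \<ge> 3 \<and> {last p, hd p} \<in> E"

definition is_tree :: "'a set \<Rightarrow> 'a set set \<Rightarrow> bool" where
  "is_tree V E \<longleftrightarrow>
     V \<noteq> {} \<and> (\<forall>e\<in>E. e \<subseteq> V \<and> card e = 2) \<and>
     (\<forall>u\<in>V. \<forall>v\<in>V. \<exists>p. is_path V E p \<and> hd p = u \<and> last p = v) \<and>
     (\<nexists>p. is_cycle V E p)"

text \<open>A rooted tree is a pair \<open>(E, r)\<close> of a tree \<open>E\<close> and a distinguished node \<open>r\<close>.\<close>

definition rooted_trees :: "'a set \<Rightarrow> ('a set set \<times> 'a) set" where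
  "rooted_trees V = {(E, r). is_tree V E \<and> r \<in> V}"

text \<open>The parent of a non-root node \<open>v\<close> is its successor on the path from \<open>v\<close> to the root.\<close>

definition is_parent :: "'a set \<Rightarrow> 'a set set \<Rightarrow> 'a \<Rightarrow> 'a \<Rightarrow> 'a \<Rightarrow> bool" where
  "is_parent V E r v u \<longleftrightarrow> (\<exists>p. is_path V E (v # u # p) \<and> last (u # p) = r)"

definition descents :: "nat set \<Rightarrow> nat set set \<Rightarrow> nat \<Rightarrow> nat set" where
  "descents V E r = {v \<in> V. v \<noteq> r \<and> (\<exists>u. is_parent V E r v u \<and> v < u)}"

definition trees_with_descents :: "nat \<Rightarrow> nat \<Rightarrow> (nat set set \<times> nat) set" where
  "trees_with_descents n i =
     {(E, r) \<in> rooted_trees {1..n}. card (descents {1..n} E r) = i}"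

end

theory Submission
  imports Defs
begin

text \<open>A rooted forest on \<open>[n]\<close> determines a weighted partition: its blocks are the trees, weighted by
  their numbers of descents.  The Moebius function from the bottom to \<open>Q\<close> is the sum of
  \<open>(-1)\<close> to the number of non-root nodes over all forests whose weighted partition is \<open>Q\<close>: it has to
  be shown that for \<open>Q\<close> different from the bottom, the signs of the forests whose partition is below
  \<open>Q\<close> cancel.  Such a forest restricts to every block \<open>C\<close> of \<open>Q\<close>, where the weight of \<open>C\<close> exceeds
  the number of descents by some \<open>k\<close> less than the number of roots; let \<open>m\<close> be the root with exactly
  \<open>k\<close> smaller roots in \<open>C\<close>.  If \<open>C\<close> is not a singleton, some other node of \<open>C\<close> is a root or a child of
  \<open>m\<close>; switching the least such node between these two states changes the sign, and changes \<open>k\<close> and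
  the number of descents by opposite amounts, so \<open>m\<close> is preserved.\<close>

section \<open>Moebius functions and sign-reversing involutions\<close>

text \<open>Away from the diagonal, the defining recursion says exactly that the values over the
  interval from \<open>x\<close> to \<open>y\<close> sum to 0, so any \<open>h\<close> with these
  vanishing sums agrees with it, by induction on the size of the interval. A guessed closed form
  thus only needs its interval sums checked.\<close>

lemma moebius_eqI:
  fixes h :: "'a \<Rightarrow> int"
  assumes lf: "locally_finite_poset r"
    and hx: "h x = 1"
    and sum0: "\<And>y. (x, y) \<in> r \<Longrightarrow> y \<noteq> x \<Longrightarrow> (\<Sum>z\<in>{z. (x, z) \<in> r \<and> (z, y) \<in> r}. h z) = 0"
    and xy: "(x, y) \<in> r"
  shows "moebius r x y = h y"
  using xy
proof (induction "card {w. (x, w) \<in> r \<and> (w, y) \<in> r}" arbitrary: y rule: less_induct)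
  case less
  have tr: "trans r" and as: "antisym r" and re: "refl_on (Field r) r"
    and fin: "\<And>x y. finite {z. (x, z) \<in> r \<and> (z, y) \<in> r}"
    using lf by (auto simp: locally_finite_poset_def partial_order_on_def preorder_on_def)
  have yy: "(y, y) \<in> r"
    using re less.prems by (auto simp: refl_on_def Field_def)
  show ?case
  proof (cases "y = x")
    case True
    then show ?thesis by (simp add: hx moebius.simps)
  next
    case False
    let ?I = "{z. (x, z) \<in> r \<and> (z, y) \<in> r}"
    have IH: "moebius r x z = h z" if z: "z \<in> ?I - {y}" for z
    proof (rule less.hyps)
      have "{w. (x, w) \<in> r \<and> (w, z) \<in> r} \<subset> ?I"
        using z tr as yy less.prems by (auto dest: transD antisymD)
      then show "card {w. (x, w) \<in> r \<and> (w, z) \<in> r} < card ?I"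
        using fin by (intro psubset_card_mono)
    qed (use z in auto)
    have "{z. (x, z) \<in> r \<and> (z, y) \<in> r \<and> z \<noteq> y} = ?I - {y}" by auto
    then have "moebius r x y = - (\<Sum>z\<in>?I - {y}. moebius r x z)"
      using False lf less.prems by (subst moebius.simps) auto
    also have "\<dots> = - (\<Sum>z\<in>?I - {y}. h z)"
      using IH by simp
    also have "\<dots> = h y"
      using sum0[OF less.prems False] sum.remove[of ?I y h] fin yy less.prems by simp
    finally show ?thesis .
  qed
qed

text \<open>Reindexing along \<open>g\<close> shows that the sum equals its own negative. A fixed
  point of \<open>g\<close> does no harm, since the sign condition makes \<open>f\<close> vanish
  there.\<close>

lemma sum_involution_eq_0:
  fixes f :: "'a \<Rightarrow> int"
  assumes "\<And>x. x \<in> S \<Longrightarrow> g x \<in> S" "\<And>x. x \<in> S \<Longrightarrow> g (g x) = x"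
    and "\<And>x. x \<in> S \<Longrightarrow> f (g x) = - f x"
  shows "sum f S = 0"
proof -
  have "sum f S = (\<Sum>x\<in>S. - f x)"
    using assms by (intro sum.reindex_bij_witness[of S g g]) auto
  then show ?thesis by (simp add: sum_negf)
qed

section \<open>Ranks in finite linearly ordered sets\<close>

text \<open>Adding a new maximum \<open>b\<close> leaves the ranks of the old elements unchanged,
  and \<open>b\<close> itself takes the one new rank \<open>card A\<close>.\<close>

lemma ex_rank_eq:
  fixes A :: "'a::linorder set"
  assumes "finite A" "k < card A"
  shows "\<exists>m\<in>A. card {s \<in> A. s < m} = k"
  using assms
proof (induction A rule: finite_linorder_max_induct)
  case (insert b A)
  have b: "b \<notin> A" using insert.hyps by auto
  show ?case
  proof (cases "k = card A")
    case True
    have "{s \<in> insert b A. s < b} = A" using insert.hyps by auto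
    then show ?thesis using True by auto
  next
    case False
    then have "k < card A" using insert b by simp
    then obtain m where m: "m \<in> A" "card {s \<in> A. s < m} = k" using insert.IH by auto
    have "{s \<in> insert b A. s < m} = {s \<in> A. s < m}"
      using insert.hyps m by auto
    then show ?thesis using m by (intro bexI[of _ m]) auto
  qed
qed simp

lemma rank_inj:
  fixes A :: "'a::linorder set"
  assumes "finite A" "m \<in> A" "m' \<in> A" "card {s \<in> A. s < m} = card {s \<in> A. s < m'}"
  shows "m = m'"
proof -
  have lt: "card {s \<in> A. s < a} < card {s \<in> A. s < b}" if "a \<in> A" "a < b" for a b
    using assms(1) that by (intro psubset_card_mono) auto
  show ?thesis
    using lt[of m m'] lt[of m' m] assms by (metis less_irrefl linorder_neqE)
qed

section \<open>Rooted forests as parent functions\<close>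

text \<open>The roots of a forest are the fixed points of its parent function.\<close>

inductive root_of :: "('a \<Rightarrow> 'a) \<Rightarrow> 'a \<Rightarrow> 'a \<Rightarrow> bool" for p where
  root: "p x = x \<Longrightarrow> root_of p x x"
| step: "p x \<noteq> x \<Longrightarrow> root_of p (p x) r \<Longrightarrow> root_of p x r"

definition roots :: "('a \<Rightarrow> 'a) \<Rightarrow> 'a set \<Rightarrow> 'a set" where
  "roots p D = {x \<in> D. p x = x}"

definition descent_nodes :: "('a::linorder \<Rightarrow> 'a) \<Rightarrow> 'a set \<Rightarrow> 'a set" where
  "descent_nodes p D = {x \<in> D. x < p x}"

text \<open>Acyclicity is encoded by demanding that iteration of \<open>p\<close> from every node
  ends in a fixed point. Extensional functions make one forest correspond to exactly one
  function.\<close>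

definition forests :: "'a set \<Rightarrow> ('a \<Rightarrow> 'a) set" where
  "forests V = {p \<in> V \<rightarrow>\<^sub>E V. \<forall>x\<in>V. \<exists>r. root_of p x r}"

definition tree_of :: "'a set \<Rightarrow> ('a \<Rightarrow> 'a) \<Rightarrow> 'a \<Rightarrow> 'a set" where
  "tree_of V p r = {x \<in> V. root_of p x r}"

definition weighted_tree_of :: "'a::linorder set \<Rightarrow> ('a \<Rightarrow> 'a) \<Rightarrow> 'a \<Rightarrow> 'a set \<times> nat" where
  "weighted_tree_of V p r = (tree_of V p r, card (descent_nodes p (tree_of V p r)))"

definition forest_partition :: "'a::linorder set \<Rightarrow> ('a \<Rightarrow> 'a) \<Rightarrow> ('a set \<times> nat) set" where
  "forest_partition V p = weighted_tree_of V p ` roots p V"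

text \<open>Each non-root node carries the edge to its parent, so the exponent is the number of
  edges.\<close>

definition forest_sign :: "'a set \<Rightarrow> ('a \<Rightarrow> 'a) \<Rightarrow> int" where
  "forest_sign V p = (- 1) ^ card {x \<in> V. p x \<noteq> x}"

lemma root_of_unique: "root_of p x r \<Longrightarrow> root_of p x s \<Longrightarrow> r = s"
proof (induction rule: root_of.induct)
  case (root x)
  then show ?case by (auto elim: root_of.cases)
next
  case (step x r)
  from step.prems step.hyps step.IH show ?case by (auto elim: root_of.cases)
qed

lemma root_of_fixed: "root_of p x r \<Longrightarrow> p r = r"
  by (induction rule: root_of.induct) auto

lemma root_of_closed: "root_of p x r \<Longrightarrow> x \<in> D \<Longrightarrow> (\<And>y. y \<in> D \<Longrightarrow> p y \<in> D) \<Longrightarrow> r \<in> D"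
  by (induction rule: root_of.induct) auto

lemma root_of_image: "root_of p x r \<Longrightarrow> root_of p (p x) r"
  by (metis root_of.cases)

lemma root_of_root_iff: "p x = x \<Longrightarrow> root_of p x r \<longleftrightarrow> r = x"
  using root_of.root root_of_unique by metis

lemma finite_forests: "finite V \<Longrightarrow> finite (forests V)"
  unfolding forests_def using finite_PiE[of V "\<lambda>_. V"] by simp

lemma forests_in: "p \<in> forests V \<Longrightarrow> x \<in> V \<Longrightarrow> p x \<in> V"
  by (auto simp: forests_def)

lemma tree_of_subset: "tree_of V p r \<subseteq> V"
  by (auto simp: tree_of_def)

lemma roots_subset: "roots p D \<subseteq> D"
  by (auto simp: roots_def)

lemma root_in_tree_of: "r \<in> roots p V \<Longrightarrow> r \<in> tree_of V p r"
  by (auto simp: tree_of_def roots_def intro: root_of.root)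

lemma forests_obtain_root:
  assumes "p \<in> forests V" "x \<in> V"
  obtains r where "r \<in> roots p V" "x \<in> tree_of V p r"
proof -
  obtain r where r: "root_of p x r" using assms by (auto simp: forests_def)
  then have "r \<in> V" using assms forests_in root_of_closed by metis
  then show ?thesis
    using r root_of_fixed[OF r] assms by (intro that[of r]) (auto simp: roots_def tree_of_def)
qed

lemma tree_of_disjoint: "r \<noteq> s \<Longrightarrow> tree_of V p r \<inter> tree_of V p s = {}"
  by (auto simp: tree_of_def dest: root_of_unique)

lemma inj_on_tree_of: "inj_on (tree_of V p) (roots p V)"
proof (rule inj_onI)
  fix r s assume "r \<in> roots p V" "s \<in> roots p V" "tree_of V p r = tree_of V p s"
  then have "r \<in> tree_of V p r \<inter> tree_of V p s"
    using root_in_tree_of[of r p V] by simp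
  then show "r = s" using tree_of_disjoint[of r s V p] by blast
qed

lemma inj_on_weighted_tree_of: "inj_on (weighted_tree_of V p) (roots p V)"
  using inj_on_tree_of[of V p] by (auto simp: weighted_tree_of_def inj_on_def)

lemma forest_partition_on:
  assumes "p \<in> forests V"
  shows "partition_on V (fst ` forest_partition V p)"
proof -
  have eq: "fst ` forest_partition V p = tree_of V p ` roots p V"
    by (simp add: forest_partition_def weighted_tree_of_def image_image)
  show ?thesis
    unfolding eq
  proof (rule partition_onI)
    show "\<Union> (tree_of V p ` roots p V) = V"
    proof (intro equalityI subsetI)
      fix x assume "x \<in> V"
      then obtain r where "r \<in> roots p V" "x \<in> tree_of V p r"
        using forests_obtain_root[OF assms] by blast
      then show "x \<in> \<Union> (tree_of V p ` roots p V)" by blast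
    qed (use tree_of_subset[of V p] in auto)
    show "disjnt X Y" if XY: "X \<in> tree_of V p ` roots p V" "Y \<in> tree_of V p ` roots p V" "X \<noteq> Y"
      for X Y
    proof -
      from XY(1,2) obtain r s where "X = tree_of V p r" "Y = tree_of V p s" by blast
      then show ?thesis using tree_of_disjoint[of r s V p] XY(3) by (auto simp: disjnt_def)
    qed
    show "{} \<notin> tree_of V p ` roots p V"
      using root_in_tree_of[of _ p V] by auto
  qed
qed

lemma forest_partition_weighted:
  assumes "p \<in> forests {1..n}"
  shows "forest_partition {1..n} p \<in> weighted_partitions n"
proof -
  have "card (descent_nodes p (tree_of {1..n} p r)) \<le> card (tree_of {1..n} p r) - 1"
    if "r \<in> roots p {1..n}" for r
  proof -
    have "finite (tree_of {1..n} p r)"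
      using tree_of_subset[of "{1..n}" p r] finite_subset by blast
    moreover have "descent_nodes p (tree_of {1..n} p r) \<subseteq> tree_of {1..n} p r - {r}"
      using that by (auto simp: descent_nodes_def roots_def)
    ultimately show ?thesis
      using root_in_tree_of[OF that] by (metis card_Diff_singleton card_mono finite_Diff)
  qed
  moreover have "inj_on fst (forest_partition {1..n} p)"
    using inj_on_tree_of[of "{1..n}" p]
    by (auto simp: forest_partition_def weighted_tree_of_def inj_on_def)
  ultimately show ?thesis
    using forest_partition_on[OF assms]
    by (auto simp: weighted_partitions_def forest_partition_def weighted_tree_of_def)
qed

text \<open>The set \<open>D\<close> is a union of whole trees. Hence the blocks in \<open>S\<close>
  correspond to the roots in \<open>D\<close>, and the descents of these disjoint trees add up to
  the descents in \<open>D\<close>. Condition (b) of the order can therefore be read off from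
  \<open>p\<close> on a block.\<close>

lemma forest_partition_subset:
  assumes fin: "finite V" and S: "S \<subseteq> forest_partition V p" and D: "D = \<Union> (fst ` S)"
  shows "card S = card (roots p D)"
    and "(\<Sum>a\<in>S. snd a) = card (descent_nodes p D)"
proof -
  have DV: "D \<subseteq> V"
  proof -
    have "fst a \<subseteq> V" if "a \<in> S" for a
    proof -
      have "a \<in> weighted_tree_of V p ` roots p V"
        using that S unfolding forest_partition_def by blast
      then obtain r where "a = weighted_tree_of V p r" by blast
      then show ?thesis using tree_of_subset[of V p r] by (simp add: weighted_tree_of_def)
    qed
    then show ?thesis unfolding D by blast
  qed
  then have finD: "finite D" using fin finite_subset by blast
  have S_eq: "S = weighted_tree_of V p ` roots p D"
  proof (intro equalityI subsetI)
    fix a assume a: "a \<in> S"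
    then have "a \<in> weighted_tree_of V p ` roots p V"
      using S unfolding forest_partition_def by blast
    then obtain r where r: "r \<in> roots p V" "a = weighted_tree_of V p r" by blast
    then have "r \<in> D"
      using a D root_in_tree_of[OF r(1)] by (force simp: weighted_tree_of_def)
    then show "a \<in> weighted_tree_of V p ` roots p D"
      using r by (auto simp: roots_def)
  next
    fix a assume "a \<in> weighted_tree_of V p ` roots p D"
    then obtain r where r: "r \<in> D" "p r = r" "a = weighted_tree_of V p r"
      by (auto simp: roots_def)
    then obtain b where b: "b \<in> S" "r \<in> fst b" using D by auto
    then obtain s where s: "b = weighted_tree_of V p s"
      using S unfolding forest_partition_def by blast
    \<comment> \<open>As \<open>r\<close> is a fixed point, the only tree containing it is its
      own.\<close>
    then have "s = r"
      using b r by (auto simp: weighted_tree_of_def tree_of_def root_of_root_iff)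
    then show "a \<in> S" using b s r by simp
  qed
  have inj: "inj_on (weighted_tree_of V p) (roots p D)"
    using DV by (intro inj_on_subset[OF inj_on_weighted_tree_of[of V p]]) (auto simp: roots_def)
  then show "card S = card (roots p D)"
    unfolding S_eq by (rule card_image)
  have D_eq: "D = (\<Union>r\<in>roots p D. tree_of V p r)"
    using D unfolding S_eq by (simp add: weighted_tree_of_def)
  have "(\<Sum>a\<in>S. snd a) = (\<Sum>r\<in>roots p D. card (descent_nodes p (tree_of V p r)))"
    unfolding S_eq by (subst sum.reindex[OF inj]) (simp add: weighted_tree_of_def)
  also have "\<dots> = card (\<Union>r\<in>roots p D. descent_nodes p (tree_of V p r))"
  proof (rule card_UN_disjoint[symmetric])
    show "finite (roots p D)" using finD by (simp add: roots_def)
    show "\<forall>r\<in>roots p D. finite (descent_nodes p (tree_of V p r))"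
      using fin by (auto simp: descent_nodes_def tree_of_def)
    show "\<forall>r\<in>roots p D. \<forall>s\<in>roots p D. r \<noteq> s \<longrightarrow>
      descent_nodes p (tree_of V p r) \<inter> descent_nodes p (tree_of V p s) = {}"
      using tree_of_disjoint[of _ _ V p] by (fastforce simp: descent_nodes_def)
  qed
  also have "(\<Union>r\<in>roots p D. descent_nodes p (tree_of V p r)) = descent_nodes p (\<Union>r\<in>roots p D. tree_of V p r)"
    by (auto simp: descent_nodes_def)
  also have "\<dots> = descent_nodes p D"
    using D_eq by simp
  finally show "(\<Sum>a\<in>S. snd a) = card (descent_nodes p D)" .
qed

section \<open>Forests whose partition lies below a given weighted partition\<close>

text \<open>This is the order relation seen from a single block: closure under \<open>p\<close>
  stands for refinement, and the two inequalities are condition (b), with the roots counting the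
  merged blocks and the descents giving their total weight.\<close>

definition fits_block :: "('a::linorder \<Rightarrow> 'a) \<Rightarrow> 'a set \<times> nat \<Rightarrow> bool" where
  "fits_block p b \<longleftrightarrow> (\<forall>x\<in>fst b. p x \<in> fst b) \<and> card (descent_nodes p (fst b)) \<le> snd b \<and>
     snd b < card (descent_nodes p (fst b)) + card (roots p (fst b))"

text \<open>A tree and the parent of any of its nodes lie in the same block of a coarser partition,
  so refinement gives closure. Conversely, a block closed under \<open>p\<close> contains the root
  of each of its nodes, so no tree is split between two blocks.\<close>

lemma forest_partition_le_iff:
  assumes p: "p \<in> forests {1..n}" and Q: "Q \<in> weighted_partitions n"
  shows "wp_le n (forest_partition {1..n} p) Q \<longleftrightarrow> (\<forall>b\<in>Q. fits_block p b)"
proof -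
  let ?P = "forest_partition {1..n} p"
  have P: "?P \<in> weighted_partitions n" using forest_partition_weighted[OF p] .
  have partQ: "partition_on {1..n} (fst ` Q)" using Q by (simp add: weighted_partitions_def)
  have weight: "int (snd b) - (\<Sum>(A, w)\<in>S. int w) \<in> {0..int (card S) - 1} \<longleftrightarrow>
      card (descent_nodes p (fst b)) \<le> snd b \<and>
      snd b < card (descent_nodes p (fst b)) + card (roots p (fst b))"
    if "S \<subseteq> ?P" "fst b = \<Union> (fst ` S)" for S and b :: "nat set \<times> nat"
  proof -
    have "(\<Sum>(A, w)\<in>S. int w) = int (card (descent_nodes p (fst b)))"
      using forest_partition_subset(2)[OF _ that] by (simp add: case_prod_unfold flip: of_nat_sum)
    then show ?thesis
      using forest_partition_subset(1)[OF _ that] by auto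
  qed
  show ?thesis
  proof
    assume le: "wp_le n ?P Q"
    then have ref: "refines {1..n} (fst ` ?P) (fst ` Q)" by (simp add: wp_le_def)
    show "\<forall>b\<in>Q. fits_block p b"
    proof
      fix b assume b: "b \<in> Q"
      have bV: "fst b \<subseteq> {1..n}" using b partQ by (auto simp: partition_on_def)
      have closed: "p x \<in> fst b" if x: "x \<in> fst b" for x
      proof -
        obtain r where r: "r \<in> roots p {1..n}" "x \<in> tree_of {1..n} p r"
          using forests_obtain_root[OF p] x bV by blast
        then have "tree_of {1..n} p r \<in> fst ` ?P"
          by (force simp: forest_partition_def weighted_tree_of_def)
        then obtain c where c: "c \<in> Q" "tree_of {1..n} p r \<subseteq> fst c"
          using ref by (auto simp: refines_def)
        then have "c = b" using wp_block_eq[OF Q c(1) b, of x] r x by auto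
        moreover have "p x \<in> tree_of {1..n} p r"
          using r forests_in[OF p] root_of_image by (fastforce simp: tree_of_def)
        ultimately show ?thesis using c by auto
      qed
      define S where "S = {a \<in> ?P. fst a \<subseteq> fst b}"
      have "partition_on (fst b) {q \<in> fst ` ?P. q \<subseteq> fst b}"
        using refines_obtains_subset[OF ref, of "fst b"] b by force
      moreover have "{q \<in> fst ` ?P. q \<subseteq> fst b} = fst ` S"
        by (auto simp: S_def)
      ultimately have S: "S \<subseteq> ?P" "fst b = \<Union> (fst ` S)"
        by (auto simp: partition_on_def S_def)
      have "int (snd b) - (\<Sum>(A, w)\<in>S. int w) \<in> {0..int (card S) - 1}"
        using le b S by (cases b) (auto simp: wp_le_def)
      then show "fits_block p b"
        using weight[OF S] closed by (simp add: fits_block_def)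
    qed
  next
    assume fits: "\<forall>b\<in>Q. fits_block p b"
    have "\<exists>Y\<in>fst ` Q. X \<subseteq> Y" if X: "X \<in> fst ` ?P" for X
    proof -
      obtain r where r: "r \<in> roots p {1..n}" "X = tree_of {1..n} p r"
        using X by (auto simp: forest_partition_def weighted_tree_of_def)
      \<comment> \<open>Iterating \<open>p\<close> from \<open>x\<close> stays inside the block of
        \<open>x\<close> and ends in \<open>r\<close>; the block containing \<open>r\<close> is
        therefore the same for all nodes of the tree.\<close>
      have get: "\<exists>b\<in>Q. x \<in> fst b \<and> r \<in> fst b" if x: "x \<in> X" for x
      proof -
        have "x \<in> \<Union> (fst ` Q)"
          using partQ x r tree_of_subset[of "{1..n}" p r] by (auto simp: partition_on_def)
        then obtain b where b: "b \<in> Q" "x \<in> fst b" by auto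
        then have "\<And>y. y \<in> fst b \<Longrightarrow> p y \<in> fst b" using fits by (auto simp: fits_block_def)
        then have "r \<in> fst b"
          using x b r root_of_closed[of p x r "fst b"] by (auto simp: tree_of_def)
        then show ?thesis using b by auto
      qed
      obtain b where b: "b \<in> Q" "r \<in> fst b"
        using get[of r] r root_in_tree_of[OF r(1)] by blast
      have "X \<subseteq> fst b"
      proof
        fix x assume "x \<in> X"
        then obtain c where "c \<in> Q" "x \<in> fst c" "r \<in> fst c" using get by blast
        then show "x \<in> fst b" using wp_block_eq[OF Q, of b c r] b by auto
      qed
      then show ?thesis using b by auto
    qed
    then have "refines {1..n} (fst ` ?P) (fst ` Q)"
      using partQ forest_partition_on[OF p] by (simp add: refines_def)
    moreover have "int v - (\<Sum>(A, w)\<in>S. int w) \<in> {0..int (card S) - 1}"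
      if "(B, v) \<in> Q" "S \<subseteq> ?P" "B = \<Union> (fst ` S)" for B v S
      using weight[of S "(B, v)"] that fits by (auto simp: fits_block_def)
    ultimately show "wp_le n ?P Q"
      by (auto simp: wp_le_def)
  qed
qed

section \<open>The involution\<close>

text \<open>A weight \<open>u\<close> that is admissible for a block \<open>C\<close> amounts to a root \<open>m\<close> of \<open>C\<close>: attaching all
  other roots of \<open>C\<close> to \<open>m\<close> turns the roots below \<open>m\<close> into descents, and yields a tree
  with exactly \<open>u\<close> descents.\<close>

definition marked_root :: "('a::linorder \<Rightarrow> 'a) \<Rightarrow> 'a set \<Rightarrow> nat \<Rightarrow> 'a \<Rightarrow> bool" where
  "marked_root p C u m \<longleftrightarrow> m \<in> roots p C \<and>
     card {s \<in> roots p C. s < m} + card (descent_nodes p C) = u"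

lemma marked_root_unique:
  assumes "finite C" "marked_root p C u m" "marked_root p C u m'"
  shows "m = m'"
  using assms roots_subset[of p C] finite_subset[of "roots p C" C]
  by (intro rank_inj[of "roots p C" m m']) (auto simp: marked_root_def)

text \<open>The excess of the weight over the number of descents is admissible iff it is the rank of
  some root, and the ranks of the roots run through all numbers below their count.\<close>

lemma fits_block_iff_marked_root:
  assumes "finite (fst b)"
  shows "fits_block p b \<longleftrightarrow>
    (\<forall>x\<in>fst b. p x \<in> fst b) \<and> (\<exists>m. marked_root p (fst b) (snd b) m)"
proof -
  let ?R = "roots p (fst b)" and ?d = "card (descent_nodes p (fst b))"
  have fin: "finite ?R" using assms by (simp add: roots_def)
  have "?d \<le> snd b \<and> snd b < ?d + card ?R \<longleftrightarrow> (\<exists>m. marked_root p (fst b) (snd b) m)"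
  proof
    assume l: "?d \<le> snd b \<and> snd b < ?d + card ?R"
    then have "snd b - ?d < card ?R" by auto
    from ex_rank_eq[OF fin this] obtain m where m: "m \<in> ?R" "card {s \<in> ?R. s < m} = snd b - ?d"
      by blast
    then have "marked_root p (fst b) (snd b) m"
      using l by (simp add: marked_root_def)
    then show "\<exists>m. marked_root p (fst b) (snd b) m" ..
  next
    assume "\<exists>m. marked_root p (fst b) (snd b) m"
    then obtain m where m: "m \<in> ?R" "card {s \<in> ?R. s < m} + ?d = snd b"
      by (auto simp: marked_root_def)
    then have "card {s \<in> ?R. s < m} < card ?R"
      using fin by (intro psubset_card_mono) auto
    then show "?d \<le> snd b \<and> snd b < ?d + card ?R" using m by linarith
  qed
  then show ?thesis by (simp add: fits_block_def)
qed

section \<open>Attaching one root to another\<close>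

text \<open>Only the chains ending in \<open>c\<close> change: they now take one more step and end
  in \<open>m\<close>. The root itself may differ on the two sides, hence the two separate
  existential quantifiers.\<close>

lemma root_of_ex_attach_iff:
  assumes "p c = c" "p m = m" "c \<noteq> m"
  shows "(\<exists>r. root_of p x r) \<longleftrightarrow> (\<exists>r. root_of (p(c := m)) x r)"
proof
  let ?q = "p(c := m)"
  have m: "root_of ?q m m" using assms by (intro root_of.root) auto
  show "\<exists>r. root_of ?q x r" if "\<exists>r. root_of p x r"
  proof -
    from that obtain r where "root_of p x r" ..
    then show ?thesis
    proof (induction rule: root_of.induct)
      case (root x)
      show ?case
      proof (cases "x = c")
        case True
        then have "root_of ?q x m" using m assms root_of.step[of ?q x m] by simp
        then show ?thesis ..
      next
        case False
        then have "root_of ?q x x" using root by (intro root_of.root) auto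
        then show ?thesis ..
      qed
    next
      case (step x r)
      then have "?q x = p x" using assms by auto
      then show ?case using step root_of.step[of ?q x] by metis
    qed
  qed
  show "\<exists>r. root_of p x r" if "\<exists>r. root_of ?q x r"
  proof -
    from that obtain r where "root_of ?q x r" ..
    then show ?thesis
    proof (induction rule: root_of.induct)
      case (root x)
      then have "p x = x" using assms by (auto split: if_splits)
      then show ?case using root_of.root by metis
    next
      case (step x r)
      show ?case
      proof (cases "x = c")
        case True
        then show ?thesis using assms root_of.root by metis
      next
        case False
        then have "?q x = p x" by simp
        then show ?thesis using step root_of.step[of p x] by metis
      qed
    qed
  qed
qed

lemma forests_attach_iff:
  assumes "p c = c" "p m = m" "c \<noteq> m" "c \<in> V" "m \<in> V"
  shows "p(c := m) \<in> forests V \<longleftrightarrow> p \<in> forests V"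
proof -
  have "p(c := m) \<in> V \<rightarrow>\<^sub>E V \<longleftrightarrow> p \<in> V \<rightarrow>\<^sub>E V"
    using assms by (auto simp: PiE_iff extensional_def)
  then show ?thesis
    using root_of_ex_attach_iff[OF assms(1-3)] by (auto simp: forests_def)
qed

text \<open>If \<open>c < m\<close>, then \<open>c\<close> stops being a root below \<open>m\<close>
  but becomes a descent, its parent now being \<open>m\<close>. If \<open>c > m\<close>, neither
  count changes. The sum is the same in both cases.\<close>

lemma marked_root_attach_iff:
  assumes "p c = c" "p m = m" "c \<noteq> m" "c \<in> C" "m \<in> C" "finite C"
  shows "marked_root (p(c := m)) C u m \<longleftrightarrow> marked_root p C u m"
proof -
  let ?q = "p(c := m)"
  have R: "{s \<in> roots ?q C. s < m} = {s \<in> roots p C. s < m} - {c}"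
    and D: "descent_nodes ?q C = descent_nodes p C \<union> (if c < m then {c} else {})"
    using assms by (auto simp: roots_def descent_nodes_def)
  have fin: "finite {s \<in> roots p C. s < m}" "finite (descent_nodes p C)"
    using assms by (auto simp: roots_def descent_nodes_def)
  have "card {s \<in> roots ?q C. s < m} + card (descent_nodes ?q C) =
        card {s \<in> roots p C. s < m} + card (descent_nodes p C)"
  proof (cases "c < m")
    case True
    have "c \<in> {s \<in> roots p C. s < m}" using assms True by (auto simp: roots_def)
    moreover from this have "card {s \<in> roots p C. s < m} > 0" using fin by (auto simp: card_gt_0_iff)
    moreover have "c \<notin> descent_nodes p C" using assms by (auto simp: descent_nodes_def)
    ultimately show ?thesis using fin True unfolding R D by simp
  next
    case False
    then have "{s \<in> roots p C. s < m} - {c} = {s \<in> roots p C. s < m}" by auto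
    then show ?thesis using False unfolding R D by simp
  qed
  moreover have "m \<in> roots ?q C" "m \<in> roots p C" using assms by (auto simp: roots_def)
  ultimately show ?thesis by (simp add: marked_root_def)
qed

lemma forest_sign_attach:
  assumes "p c = c" "c \<noteq> m" "c \<in> V" "finite V"
  shows "forest_sign V (p(c := m)) = - forest_sign V p"
proof -
  have "{x \<in> V. (p(c := m)) x \<noteq> x} = insert c {x \<in> V. p x \<noteq> x}"
    using assms by auto
  then show ?thesis using assms by (simp add: forest_sign_def)
qed

text \<open>By \<open>forest_partition_le_iff\<close> these are the forests whose partition is below
  \<open>Q\<close>, described block by block so that they can be altered within one block.\<close>

definition fitting_forests :: "nat \<Rightarrow> (nat set \<times> nat) set \<Rightarrow> (nat \<Rightarrow> nat) set" where
  "fitting_forests n Q = {p \<in> forests {1..n}. \<forall>b\<in>Q. fits_block p b}"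

lemma fits_block_cong:
  assumes "\<And>x. x \<in> fst b \<Longrightarrow> p x = q x"
  shows "fits_block p b \<longleftrightarrow> fits_block q b"
proof -
  have "descent_nodes p (fst b) = descent_nodes q (fst b)" "roots p (fst b) = roots q (fst b)"
    using assms by (auto simp: descent_nodes_def roots_def)
  then show ?thesis using assms by (simp add: fits_block_def)
qed

text \<open>By disjointness, no block other than \<open>b\<close> contains \<open>c\<close>, so the
  change at \<open>c\<close> is invisible there; within \<open>b\<close> the marked root survives.
  As an equivalence this covers both directions of the switch, attaching \<open>c\<close> and
  detaching it.\<close>

lemma fitting_forests_attach_iff:
  assumes Q: "Q \<in> weighted_partitions n" and b: "b \<in> Q" "c \<in> fst b" "m \<in> fst b"
    and c: "p c = c" "p m = m" "c \<noteq> m"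
  shows "p(c := m) \<in> fitting_forests n Q \<and> marked_root (p(c := m)) (fst b) (snd b) m \<longleftrightarrow>
    p \<in> fitting_forests n Q \<and> marked_root p (fst b) (snd b) m"
proof -
  have sub: "fst b \<subseteq> {1..n}"
    using Q b by (auto simp: weighted_partitions_def partition_on_def)
  then have fin: "finite (fst b)" using finite_subset by blast
  have "fits_block (p(c := m)) d \<longleftrightarrow> fits_block p d" if "d \<in> Q - {b}" for d
  proof (rule fits_block_cong)
    fix x assume "x \<in> fst d"
    then have "x \<noteq> c" using wp_block_eq[OF Q, of d b c] that b by auto
    then show "(p(c := m)) x = p x" by simp
  qed
  moreover have "(\<forall>x\<in>fst b. (p(c := m)) x \<in> fst b) \<longleftrightarrow> (\<forall>x\<in>fst b. p x \<in> fst b)"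
    using b c by auto
  moreover have "marked_root (p(c := m)) (fst b) (snd b) m \<longleftrightarrow> marked_root p (fst b) (snd b) m"
    using marked_root_attach_iff[OF c b(2,3) fin] .
  moreover have "p(c := m) \<in> forests {1..n} \<longleftrightarrow> p \<in> forests {1..n}"
    using forests_attach_iff[OF c] b sub by blast
  moreover have "(\<forall>d\<in>Q. P d) \<longleftrightarrow> P b \<and> (\<forall>d\<in>Q - {b}. P d)" for P using b by auto
  ultimately show ?thesis
    unfolding fitting_forests_def mem_Collect_eq using fits_block_iff_marked_root[OF fin]
    by (metis (no_types, lifting))
qed

text \<open>These are the nodes that can be switched between being a root and being a child of
  \<open>m\<close>. Switching one of them leaves this set unchanged, so its minimum is the same
  before and after.\<close>

definition pivots :: "('a \<Rightarrow> 'a) \<Rightarrow> 'a set \<Rightarrow> 'a \<Rightarrow> 'a set" where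
  "pivots p C m = {c \<in> C. c \<noteq> m \<and> (p c = c \<or> p c = m)}"

text \<open>Following parents from a node other than \<open>m\<close>, one meets either a root
  different from \<open>m\<close> or a child of \<open>m\<close>, without leaving
  \<open>C\<close>.\<close>

lemma pivots_nonempty:
  assumes "root_of p x r" "x \<in> C" "x \<noteq> m" "\<And>y. y \<in> C \<Longrightarrow> p y \<in> C"
  shows "pivots p C m \<noteq> {}"
  using assms(1-3)
proof (induction rule: root_of.induct)
  case (root x)
  then show ?case by (auto simp: pivots_def)
next
  case (step x r)
  then show ?case using assms(4) by (cases "p x = m") (auto simp: pivots_def)
qed

lemma sum_forest_sign_fitting_forests:
  assumes Q: "Q \<in> weighted_partitions n" and b: "b \<in> Q" "card (fst b) \<ge> 2"
  shows "(\<Sum>p\<in>fitting_forests n Q. forest_sign {1..n} p) = 0"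
proof -
  let ?C = "fst b" and ?u = "snd b"
  have sub: "?C \<subseteq> {1..n}"
    using Q b by (auto simp: weighted_partitions_def partition_on_def)
  then have fin: "finite ?C" using finite_subset by blast
  \<comment> \<open>The marked root is unique, so \<open>THE\<close> picks it; \<open>toggle\<close>
    then detaches the least pivot from it or attaches the pivot to it.\<close>
  define mark where "mark = (\<lambda>p. THE m. marked_root p ?C ?u m)"
  define piv where "piv = (\<lambda>p. Min (pivots p ?C (mark p)))"
  define toggle where "toggle = (\<lambda>p. p(piv p := if p (piv p) = piv p then mark p else piv p))"
  have mark: "mark p = m" if "marked_root p ?C ?u m" for p m
    unfolding mark_def using that marked_root_unique[OF fin that] by blast
  have main: "toggle p \<in> fitting_forests n Q \<and> toggle (toggle p) = p \<and>
      forest_sign {1..n} (toggle p) = - forest_sign {1..n} p"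
    if p: "p \<in> fitting_forests n Q" for p
  proof -
    have "fits_block p b" and pf: "p \<in> forests {1..n}"
      using p b by (auto simp: fitting_forests_def)
    then obtain m where m: "marked_root p ?C ?u m" and closed: "\<And>x. x \<in> ?C \<Longrightarrow> p x \<in> ?C"
      using fits_block_iff_marked_root[OF fin] by auto
    define c where "c = piv p"
    have mC: "m \<in> ?C" "p m = m" using m by (auto simp: marked_root_def roots_def)
    \<comment> \<open>This is where the size of the block enters: a second node is needed to start
      the search for a pivot.\<close>
    have "\<not> ?C \<subseteq> {m}" using b card_mono[of "{m}" ?C] by auto
    then obtain x where x: "x \<in> ?C" "x \<noteq> m" by auto
    have "x \<in> {1..n}" using x sub by blast
    then obtain r where "root_of p x r" using pf unfolding forests_def by blast
    then have ne: "pivots p ?C m \<noteq> {}" using x closed by (rule pivots_nonempty)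
    have "finite (pivots p ?C m)" using fin by (simp add: pivots_def)
    then have "c \<in> pivots p ?C m" using ne mark[OF m] Min_in by (auto simp: c_def piv_def)
    then have c: "c \<in> ?C" "c \<noteq> m" "p c = c \<or> p c = m" by (auto simp: pivots_def)
    have cV: "c \<in> {1..n}" using c sub by auto
    \<comment> \<open>The involution property rests on this: as long as the marked root is kept,
      both states of \<open>c\<close> lead to the same pivot set and so to the same choice of
      \<open>c\<close>.\<close>
    have piv_eq: "piv q = c"
      if "marked_root q ?C ?u m" "q = p(c := c) \<or> q = p(c := m)" for q
    proof -
      have "q x = p x" if "x \<noteq> c" for x using that \<open>q = _ \<or> _\<close> by auto
      moreover have "q c = c \<or> q c = m" using that by auto
      ultimately have "pivots q ?C m = pivots p ?C m"
        using c(3) unfolding pivots_def by (intro Collect_cong) metis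
      then show ?thesis using mark[OF that(1)] mark[OF m] by (simp add: piv_def c_def)
    qed
    from c(3) show ?thesis
    proof
      assume pc: "p c = c"
      then have t: "toggle p = p(c := m)"
        using mark[OF m] by (simp add: toggle_def c_def)
      have q: "p(c := m) \<in> fitting_forests n Q" "marked_root (p(c := m)) ?C ?u m"
        using fitting_forests_attach_iff[where p = p, OF Q b(1) c(1) mC(1) pc mC(2) c(2)] p m by auto
      have "toggle (p(c := m)) = p"
        using piv_eq[OF q(2)] mark[OF q(2)] c pc by (auto simp: toggle_def)
      then show ?thesis
        using t q forest_sign_attach[where p = p, OF pc c(2) cV] by simp
    next
      assume pc: "p c = m"
      \<comment> \<open>Detaching is treated as the inverse of attaching: \<open>p\<close> is
        \<open>q\<close> with \<open>c\<close> attached to \<open>m\<close>, and the attachment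
        lemmas are applied to \<open>q\<close>.\<close>
      define q where "q = p(c := c)"
      have p_eq: "q(c := m) = p" using pc by (auto simp: q_def)
      have t: "toggle p = q"
        using c pc by (simp add: toggle_def c_def q_def)
      have qc: "q c = c" "q m = m" using mC c by (auto simp: q_def)
      have q: "q \<in> fitting_forests n Q" "marked_root q ?C ?u m"
        using fitting_forests_attach_iff[where p = q, OF Q b(1) c(1) mC(1) qc c(2)] p m
        unfolding p_eq by blast+
      have "piv q = c" using piv_eq[OF q(2)] by (simp add: q_def)
      then have "toggle q = p"
        using mark[OF q(2)] qc p_eq by (simp add: toggle_def)
      moreover have "forest_sign {1..n} p = - forest_sign {1..n} q"
        using forest_sign_attach[where p = q, OF qc(1) c(2) cV] p_eq by simp
      ultimately show ?thesis
        using t q by simp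
    qed
  qed
  show ?thesis
    by (rule sum_involution_eq_0[where g = toggle]) (use main in auto)
qed

section \<open>The Moebius function as a signed count of forests\<close>

lemma wp_bottom_weighted: "wp_bottom n \<in> weighted_partitions n"
proof -
  have eq: "fst ` wp_bottom n = (\<lambda>k. {k}) ` {1..n}"
    by (simp add: wp_bottom_def image_image)
  have "partition_on {1..n} (fst ` wp_bottom n)"
    unfolding eq by (rule partition_onI) (auto simp: disjnt_def)
  then show ?thesis
    by (auto simp: weighted_partitions_def wp_bottom_def inj_on_def)
qed

lemma weighted_partition_block:
  assumes "Q \<in> weighted_partitions n" "b \<in> Q"
  shows "finite (fst b)" "snd b < card (fst b)"
proof -
  have "fst b \<subseteq> {1..n}" "snd b \<le> card (fst b) - 1"
    using assms by (auto simp: weighted_partitions_def partition_on_def)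
  then show fin: "finite (fst b)" using finite_subset by blast
  \<comment> \<open>Nonemptiness excludes the truncated case of \<open>card (fst b) - 1\<close> and
    makes the bound strict.\<close>
  then have "card (fst b) > 0" using wp_block_nonempty[OF assms] by (simp add: card_gt_0_iff)
  then show "snd b < card (fst b)" using \<open>snd b \<le> card (fst b) - 1\<close> by linarith
qed

lemma weighted_partition_ne_bottom:
  assumes Q: "Q \<in> weighted_partitions n" and ne: "Q \<noteq> wp_bottom n"
  shows "\<exists>b\<in>Q. card (fst b) \<ge> 2"
proof (rule ccontr)
  assume "\<not> (\<exists>b\<in>Q. card (fst b) \<ge> 2)"
  then have small: "card (fst b) < 2" if "b \<in> Q" for b using that by fastforce
  have single: "\<exists>k. b = ({k}, 0)" if "b \<in> Q" for b
  proof -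
    have "card (fst b) = 1" "snd b = 0"
      using small[OF that] weighted_partition_block[OF Q that] by auto
    moreover from this obtain k where "fst b = {k}" by (meson card_1_singletonE)
    ultimately show ?thesis by (intro exI[of _ k]) (simp add: prod_eq_iff)
  qed
  have U: "\<Union> (fst ` Q) = {1..n}" using Q by (auto simp: weighted_partitions_def partition_on_def)
  have "Q = wp_bottom n"
  proof (intro equalityI subsetI)
    fix b assume b: "b \<in> Q"
    then obtain k where k: "b = ({k}, 0)" using single by blast
    then have "k \<in> {1..n}" using b U by force
    then show "b \<in> wp_bottom n" using k by (simp add: wp_bottom_def)
  next
    fix b assume "b \<in> wp_bottom n"
    then obtain k where k: "k \<in> {1..n}" "b = ({k}, 0)" by (auto simp: wp_bottom_def)
    then obtain c where c: "c \<in> Q" "k \<in> fst c" using U by blast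
    then obtain j where "c = ({j}, 0)" using single by blast
    then show "b \<in> Q" using c k by simp
  qed
  then show False using ne by simp
qed

definition trivial_forest :: "nat \<Rightarrow> nat \<Rightarrow> nat" where
  "trivial_forest n = restrict id {1..n}"

lemma trivial_forest_in: "trivial_forest n \<in> forests {1..n}"
proof -
  have "root_of (trivial_forest n) x x" if "x \<in> {1..n}" for x
    using that by (intro root_of.root) (auto simp: trivial_forest_def)
  then have "\<forall>x\<in>{1..n}. \<exists>r. root_of (trivial_forest n) x r" by blast
  moreover have "trivial_forest n \<in> {1..n} \<rightarrow>\<^sub>E {1..n}" by (auto simp: trivial_forest_def)
  ultimately show ?thesis unfolding forests_def by blast
qed

lemma forest_partition_trivial: "forest_partition {1..n} (trivial_forest n) = wp_bottom n"
proof -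
  have "roots (trivial_forest n) {1..n} = {1..n}" by (auto simp: roots_def trivial_forest_def)
  moreover have "weighted_tree_of {1..n} (trivial_forest n) r = ({r}, 0)" if "r \<in> {1..n}" for r
  proof -
    have "tree_of {1..n} (trivial_forest n) r = {r}"
      using that root_of_root_iff[of "trivial_forest n"]
      by (auto simp: tree_of_def trivial_forest_def)
    moreover have "descent_nodes (trivial_forest n) {r} = {}"
      using that by (auto simp: descent_nodes_def trivial_forest_def)
    ultimately show ?thesis by (simp add: weighted_tree_of_def)
  qed
  ultimately show ?thesis by (simp add: forest_partition_def wp_bottom_def)
qed

text \<open>The bottom is the partition of the edgeless forest. There every node is a root and there
  are no descents, so a block fits as soon as its weight is smaller than its size.\<close>

lemma wp_bottom_le:
  assumes "Q \<in> weighted_partitions n"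
  shows "wp_le n (wp_bottom n) Q"
proof -
  have "fits_block (trivial_forest n) b" if "b \<in> Q" for b
  proof -
    have "fst b \<subseteq> {1..n}" using assms that by (auto simp: weighted_partitions_def partition_on_def)
    then have "\<And>x. x \<in> fst b \<Longrightarrow> trivial_forest n x = x"
      by (auto simp: trivial_forest_def)
    then have "descent_nodes (trivial_forest n) (fst b) = {}"
      "roots (trivial_forest n) (fst b) = fst b" "\<forall>x\<in>fst b. trivial_forest n x \<in> fst b"
      by (auto simp: descent_nodes_def roots_def)
    then show ?thesis
      using weighted_partition_block[OF assms that] by (simp add: fits_block_def)
  qed
  then show ?thesis
    using forest_partition_le_iff[OF trivial_forest_in assms]
    unfolding forest_partition_trivial by blast
qed

text \<open>Fitting the bottom means that every singleton is closed under \<open>p\<close>, which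
  forces each node to be a root.\<close>

lemma forest_partition_eq_bottom_iff:
  assumes p: "p \<in> forests {1..n}"
  shows "forest_partition {1..n} p = wp_bottom n \<longleftrightarrow> p = trivial_forest n"
proof
  assume "forest_partition {1..n} p = wp_bottom n"
  then have "wp_le n (forest_partition {1..n} p) (wp_bottom n)"
    using wp_le_refl[OF wp_bottom_weighted] by simp
  then have fits: "\<forall>b\<in>wp_bottom n. fits_block p b"
    using forest_partition_le_iff[OF p wp_bottom_weighted] by simp
  have "p k = trivial_forest n k" for k
  proof (cases "k \<in> {1..n}")
    case True
    then have "fits_block p ({k}, 0)" using fits by (auto simp: wp_bottom_def)
    then show ?thesis using True by (simp add: fits_block_def trivial_forest_def)
  next
    case False
    then show ?thesis
      using p PiE_arb[of p "{1..n}" "\<lambda>_. {1..n}" k] by (auto simp: forests_def trivial_forest_def)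
  qed
  then show "p = trivial_forest n" ..
next
  assume "p = trivial_forest n"
  then show "forest_partition {1..n} p = wp_bottom n"
    by (simp only: forest_partition_trivial)
qed

text \<open>The signed count of forests plays the part of \<open>h\<close> in
  \<open>moebius_eqI\<close>. It is 1 at the bottom because only the edgeless forest contributes;
  its interval sums are sums over \<open>fitting_forests\<close>, which vanish by the
  involution.\<close>

lemma moebius_wp_bottom:
  assumes Q: "Q \<in> weighted_partitions n"
  shows "moebius (weighted_partition_poset n) (wp_bottom n) Q =
    (\<Sum>p | p \<in> forests {1..n} \<and> forest_partition {1..n} p = Q. forest_sign {1..n} p)"
proof (rule moebius_eqI[OF locally_finite_weighted_partition_poset,
    where h = "\<lambda>Q. \<Sum>p | p \<in> forests {1..n} \<and> forest_partition {1..n} p = Q. forest_sign {1..n} p"])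
  let ?h = "\<lambda>Q. \<Sum>p | p \<in> forests {1..n} \<and> forest_partition {1..n} p = Q. forest_sign {1..n} p"
  have "{p. p \<in> forests {1..n} \<and> forest_partition {1..n} p = wp_bottom n} = {trivial_forest n}"
    using forest_partition_eq_bottom_iff trivial_forest_in by blast
  moreover have "{x \<in> {1..n}. trivial_forest n x \<noteq> x} = {}" by (auto simp: trivial_forest_def)
  then have "forest_sign {1..n} (trivial_forest n) = 1"
    unfolding forest_sign_def by (metis card.empty power_0)
  ultimately show "?h (wp_bottom n) = 1" by simp
next
  show "(wp_bottom n, Q) \<in> weighted_partition_poset n"
    using wp_bottom_le[OF Q] wp_bottom_weighted Q by (simp add: weighted_partition_poset_def)
next
  let ?h = "\<lambda>Q. \<Sum>p | p \<in> forests {1..n} \<and> forest_partition {1..n} p = Q. forest_sign {1..n} p"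
  fix R assume "(wp_bottom n, R) \<in> weighted_partition_poset n" and ne: "R \<noteq> wp_bottom n"
  then have R: "R \<in> weighted_partitions n" by (simp add: weighted_partition_poset_def)
  obtain b where b: "b \<in> R" "card (fst b) \<ge> 2"
    using weighted_partition_ne_bottom[OF R ne] by blast
  let ?I = "{P. (wp_bottom n, P) \<in> weighted_partition_poset n \<and> (P, R) \<in> weighted_partition_poset n}"
  have I: "?I = {P \<in> weighted_partitions n. wp_le n P R}"
    using wp_bottom_le wp_bottom_weighted R by (auto simp: weighted_partition_poset_def)
  have M: "fitting_forests n R = {p \<in> forests {1..n}. forest_partition {1..n} p \<in> ?I}"
    unfolding I fitting_forests_def
    using forest_partition_le_iff[OF _ R] forest_partition_weighted by blast
  \<comment> \<open>The forests fitting \<open>R\<close> are sorted by their partition, which ranges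
    over the interval below \<open>R\<close>.\<close>
  have "(\<Sum>P\<in>?I. ?h P) =
      (\<Sum>P\<in>?I. \<Sum>p | p \<in> fitting_forests n R \<and> forest_partition {1..n} p = P. forest_sign {1..n} p)"
    unfolding M by (intro sum.cong refl) auto
  also have "\<dots> = (\<Sum>p\<in>fitting_forests n R. forest_sign {1..n} p)"
  proof (rule sum.group)
    show "finite (fitting_forests n R)"
      using finite_forests[of "{1..n}"] by (simp add: fitting_forests_def)
    show "finite ?I" using finite_weighted_partitions[of n] unfolding I by simp
    show "forest_partition {1..n} ` fitting_forests n R \<subseteq> ?I" unfolding M by blast
  qed
  also have "\<dots> = 0" using sum_forest_sign_fitting_forests[OF R b] .
  finally show "(\<Sum>P\<in>?I. ?h P) = 0" .
qed

lemma forest_partition_eq_top_iff: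
  assumes p: "p \<in> forests {1..n}"
  shows "forest_partition {1..n} p = wp_top n i \<longleftrightarrow>
    (\<exists>r. roots p {1..n} = {r}) \<and> card (descent_nodes p {1..n}) = i"
proof
  assume eq: "forest_partition {1..n} p = wp_top n i"
  then have "card (weighted_tree_of {1..n} p ` roots p {1..n}) = 1"
    by (simp add: forest_partition_def wp_top_def)
  \<comment> \<open>Distinct roots give distinct blocks, so a single block comes from a single
    root.\<close>
  then have "card (roots p {1..n}) = 1"
    by (simp add: card_image inj_on_weighted_tree_of)
  then obtain r where r: "roots p {1..n} = {r}" using card_1_singletonE by blast
  then have "weighted_tree_of {1..n} p r = ({1..n}, i)"
    using eq by (simp add: forest_partition_def wp_top_def)
  then show "(\<exists>r. roots p {1..n} = {r}) \<and> card (descent_nodes p {1..n}) = i"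
    using r by (auto simp: weighted_tree_of_def)
next
  assume "(\<exists>r. roots p {1..n} = {r}) \<and> card (descent_nodes p {1..n}) = i"
  then obtain r where r: "roots p {1..n} = {r}" and i: "card (descent_nodes p {1..n}) = i" by blast
  have "{1..n} \<subseteq> tree_of {1..n} p r"
  proof
    fix x assume "x \<in> {1..n}"
    then obtain s where "s \<in> roots p {1..n}" "x \<in> tree_of {1..n} p s"
      using forests_obtain_root[OF p] by blast
    then show "x \<in> tree_of {1..n} p r" using r by simp
  qed
  then have "tree_of {1..n} p r = {1..n}" using tree_of_subset[of "{1..n}" p r] by blast
  then show "forest_partition {1..n} p = wp_top n i"
    using r i by (simp add: forest_partition_def wp_top_def weighted_tree_of_def)
qed

section \<open>Rooted trees and their parent functions\<close>

text \<open>Walks can be reversed and concatenated freely, unlike the repetition-free lists of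
  \<open>is_path\<close>. Shrinking \<open>V\<close> expresses that a walk avoids a vertex.\<close>

definition adj_rel :: "'a set \<Rightarrow> 'a set set \<Rightarrow> 'a rel" where
  "adj_rel V E = {(x, y). x \<in> V \<and> y \<in> V \<and> {x, y} \<in> E}"

lemma sym_adj_rel_rtrancl: "(x, y) \<in> (adj_rel V E)\<^sup>* \<Longrightarrow> (y, x) \<in> (adj_rel V E)\<^sup>*"
proof -
  have "sym (adj_rel V E)" by (auto simp: sym_def adj_rel_def insert_commute)
  then show "(x, y) \<in> (adj_rel V E)\<^sup>* \<Longrightarrow> (y, x) \<in> (adj_rel V E)\<^sup>*"
    by (metis sym_rtrancl symD)
qed

lemma is_path_Cons:
  assumes "is_path V E p" "x \<in> V" "x \<notin> set p" "{x, hd p} \<in> E"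
  shows "is_path V E (x # p)"
  using assms by (auto simp: is_path_def successively_Cons)

lemma is_path_suffix: "is_path V E (xs @ ys) \<Longrightarrow> ys \<noteq> [] \<Longrightarrow> is_path V E ys"
  by (auto simp: is_path_def successively_append_iff)

text \<open>A walk is shortened to a path from its end backwards: if the vertex to be prepended
  already occurs, the path is cut to the suffix starting there.\<close>

lemma adj_rel_rtrancl_path:
  assumes "(u, v) \<in> (adj_rel V E)\<^sup>*" "v \<in> V"
  shows "\<exists>p. is_path V E p \<and> hd p = u \<and> last p = v"
  using assms(1)
proof (induction rule: converse_rtrancl_induct)
  case base
  have "is_path V E [v]" using assms by (simp add: is_path_def)
  then show ?case by (intro exI[of _ "[v]"]) simp
next
  case (step u w)
  then obtain p where p: "is_path V E p" "hd p = w" "last p = v" by blast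
  show ?case
  proof (cases "u \<in> set p")
    case True
    then obtain xs ys where "p = xs @ u # ys" using split_list by fast
    then show ?thesis using p is_path_suffix[of V E xs "u # ys"] by (intro exI[of _ "u # ys"]) simp
  next
    case False
    have "u \<in> V" "{u, hd p} \<in> E" using step.hyps p by (auto simp: adj_rel_def)
    then have "is_path V E (u # p)" using p False is_path_Cons by metis
    then show ?thesis using p by (intro exI[of _ "u # p"]) (auto simp: is_path_def)
  qed
qed

lemma is_path_adj_rel_rtrancl: "is_path V E p \<Longrightarrow> (hd p, last p) \<in> (adj_rel V E)\<^sup>*"
proof (induction p rule: induct_list012)
  case (3 x y zs)
  then have "(x, y) \<in> adj_rel V E" by (auto simp: is_path_def adj_rel_def)
  moreover have "is_path V E (y # zs)" using 3(3) by (auto simp: is_path_def)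
  ultimately show ?case using 3(2) by (auto intro: converse_rtrancl_into_rtrancl)
qed (auto simp: is_path_def)

text \<open>Two distinct parents of \<open>v\<close> both reach the root without using
  \<open>v\<close>, hence are joined by a path avoiding \<open>v\<close>; closing it through
  \<open>v\<close> gives a cycle.\<close>

lemma is_parent_unique:
  assumes nc: "\<nexists>c. is_cycle V E c" and uv: "is_parent V E r v u" "is_parent V E r v u'"
  shows "u = u'"
proof (rule ccontr)
  assume "u \<noteq> u'"
  have reach: "(x, r) \<in> (adj_rel (V - {v}) E)\<^sup>* \<and> x \<in> V - {v} \<and> {v, x} \<in> E \<and> v \<in> V"
    if "is_parent V E r v x" for x
  proof -
    obtain p where p: "is_path V E (v # x # p)" "last (x # p) = r"
      using \<open>is_parent V E r v x\<close> unfolding is_parent_def by blast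
    then have "is_path (V - {v}) E (x # p)" by (auto simp: is_path_def)
    from is_path_adj_rel_rtrancl[OF this] show ?thesis using p by (auto simp: is_path_def)
  qed
  have "(u, u') \<in> (adj_rel (V - {v}) E)\<^sup>*"
    using reach[OF uv(1)] reach[OF uv(2)] sym_adj_rel_rtrancl rtrancl_trans by metis
  then obtain q where q: "is_path (V - {v}) E q" "hd q = u" "last q = u'"
    using adj_rel_rtrancl_path reach[OF uv(2)] by metis
  have "length q \<ge> 2"
    using q \<open>u \<noteq> u'\<close> by (cases q rule: remdups_adj.cases) (auto simp: is_path_def)
  moreover have "is_path V E (v # q)"
    using q reach[OF uv(1)] is_path_Cons[of V E q v] by (auto simp: is_path_def)
  moreover have "{last (v # q), hd (v # q)} \<in> E"
    using q reach[OF uv(2)] by (auto simp: is_path_def insert_commute)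
  ultimately have "is_cycle V E (v # q)" by (simp add: is_cycle_def)
  then show False using nc by blast
qed

section \<open>From a rooted tree to its parent function\<close>

text \<open>The root is sent to itself to match the convention for forests; in a tree the
  description is proper by \<open>is_parent_unique\<close>.\<close>

definition parent_fun :: "'a set \<Rightarrow> 'a set set \<Rightarrow> 'a \<Rightarrow> 'a \<Rightarrow> 'a" where
  "parent_fun V E r = (\<lambda>x\<in>V. if x = r then r else THE u. is_parent V E r x u)"

definition parent_edges :: "'a set \<Rightarrow> ('a \<Rightarrow> 'a) \<Rightarrow> 'a set set" where
  "parent_edges V p = {{x, p x} | x. x \<in> V \<and> p x \<noteq> x}"

lemma parent_edgesI: "x \<in> V \<Longrightarrow> p x \<noteq> x \<Longrightarrow> {x, p x} \<in> parent_edges V p"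
  unfolding parent_edges_def by blast

lemma is_parentD:
  assumes "is_parent V E r v u"
  shows "v \<in> V" "u \<in> V" "v \<noteq> u" "v \<noteq> r" "{v, u} \<in> E"
  using assms by (auto simp: is_parent_def is_path_def split: if_splits)

context
  fixes V :: "'a set" and E r
  assumes tree: "is_tree V E" and rV: "r \<in> V"
begin

lemma parent_fun_eq:
  assumes "is_parent V E r v u"
  shows "parent_fun V E r v = u"
proof -
  have "\<nexists>c. is_cycle V E c" using tree unfolding is_tree_def by blast
  then have "(THE w. is_parent V E r v w) = u"
    using assms is_parent_unique by (intro the_equality) blast+
  then show ?thesis using is_parentD[OF assms] by (simp add: parent_fun_def)
qed

lemma parent_fun_root: "parent_fun V E r r = r"
  using rV by (simp add: parent_fun_def)

lemma path_to_root:
  assumes "v \<in> V"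
  obtains p where "is_path V E (v # p)" "last (v # p) = r"
proof -
  have "\<exists>p. is_path V E p \<and> hd p = v \<and> last p = r"
    using tree rV assms unfolding is_tree_def by blast
  then obtain p where "is_path V E p" "hd p = v" "last p = r" by blast
  then show ?thesis using that[of "tl p"] by (cases p) (auto simp: is_path_def)
qed

lemma is_parent_iff:
  assumes "v \<in> V" "v \<noteq> r"
  shows "is_parent V E r v u \<longleftrightarrow> parent_fun V E r v = u"
proof -
  obtain p where p: "is_path V E (v # p)" "last (v # p) = r" using path_to_root[OF assms(1)] .
  then obtain u' p' where "p = u' # p'" using assms by (cases p) auto
  then have "is_path V E (v # u' # p')" "last (u' # p') = r" using p by simp_all
  then have u': "is_parent V E r v u'" unfolding is_parent_def by blast
  show ?thesis
  proof
    show "is_parent V E r v u" if "parent_fun V E r v = u"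
      using u' parent_fun_eq[OF u'] that by simp
  qed (rule parent_fun_eq)
qed

text \<open>On a path ending in the root, each vertex is followed by its parent, since every suffix
  is again a path to the root.\<close>

lemma root_of_parent_fun:
  "is_path V E p \<Longrightarrow> last p = r \<Longrightarrow> root_of (parent_fun V E r) (hd p) r"
proof (induction p rule: induct_list012)
  case (2 x)
  then show ?case using root_of.root[of "parent_fun V E r" r] parent_fun_root by simp
next
  case (3 x y zs)
  have "is_path V E (x # y # zs)" "last (y # zs) = r" using "3.prems" by simp_all
  then have par: "is_parent V E r x y" unfolding is_parent_def by blast
  have "parent_fun V E r x = y" "x \<noteq> y" using parent_fun_eq[OF par] is_parentD(3)[OF par] .
  moreover have "is_path V E (y # zs)"
    using "3.prems"(1) is_path_suffix[of V E "[x]" "y # zs"] by simp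
  then have "root_of (parent_fun V E r) y r" using "3.IH"(2) "3.prems"(2) by simp
  ultimately show ?case using root_of.step[of "parent_fun V E r" x r] by simp
qed (simp add: is_path_def)

lemma parent_fun_forest: "parent_fun V E r \<in> forests V"
proof -
  have "parent_fun V E r v \<in> V" if "v \<in> V" for v
  proof (cases "v = r")
    case False
    then have "is_parent V E r v (parent_fun V E r v)" using is_parent_iff[OF that] by simp
    then show ?thesis by (rule is_parentD(2))
  qed (simp add: parent_fun_root rV)
  moreover have "\<exists>s. root_of (parent_fun V E r) v s" if v: "v \<in> V" for v
  proof -
    obtain q where "is_path V E (v # q)" "last (v # q) = r" using path_to_root[OF v] .
    from root_of_parent_fun[OF this] show ?thesis by auto
  qed
  moreover have "parent_fun V E r \<in> extensional V" by (simp add: parent_fun_def)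
  ultimately show ?thesis by (auto simp: forests_def PiE_iff)
qed

lemma roots_parent_fun: "roots (parent_fun V E r) V = {r}"
proof -
  have "parent_fun V E r v \<noteq> v" if "v \<in> V" "v \<noteq> r" for v
    using is_parent_iff[OF that, of "parent_fun V E r v"] is_parentD(3)[of V E r v "parent_fun V E r v"]
    by simp
  then show ?thesis using rV parent_fun_root by (auto simp: roots_def)
qed

text \<open>For an edge between \<open>a\<close> and \<open>b\<close>, consider the path from
  \<open>a\<close> to the root. If it avoids \<open>b\<close>, prepending \<open>b\<close> shows
  that \<open>a\<close> is the parent of \<open>b\<close>. If it meets \<open>b\<close>, its part
  from \<open>b\<close> on avoids \<open>a\<close>, and prepending \<open>a\<close> to that part
  shows that \<open>b\<close> is the parent of \<open>a\<close>.\<close>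

lemma parent_edges_parent_fun: "parent_edges V (parent_fun V E r) = E"
proof (intro equalityI subsetI)
  fix e assume "e \<in> parent_edges V (parent_fun V E r)"
  then obtain x where x: "x \<in> V" "parent_fun V E r x \<noteq> x" "e = {x, parent_fun V E r x}"
    by (auto simp: parent_edges_def)
  then have "is_parent V E r x (parent_fun V E r x)"
    using is_parent_iff[of x] parent_fun_root by (cases "x = r") simp_all
  then show "e \<in> E" unfolding x(3) by (rule is_parentD(5))
next
  fix e assume e: "e \<in> E"
  then have "card e = 2" "e \<subseteq> V" using tree by (auto simp: is_tree_def)
  then obtain a b where ab: "e = {a, b}" "a \<noteq> b" "a \<in> V" "b \<in> V" by (auto simp: card_2_iff)
  obtain p where p: "is_path V E (a # p)" "last (a # p) = r" using path_to_root[OF ab(3)] .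
  have "is_parent V E r a b \<or> is_parent V E r b a"
  proof (cases "b \<in> set p")
    case True
    then obtain xs ys where ys: "p = xs @ b # ys" using split_list by fast
    then have "is_path V E (b # ys)" using p is_path_suffix[of V E "a # xs" "b # ys"] by simp
    moreover have "a \<notin> set (b # ys)" using p(1) ys by (auto simp: is_path_def)
    ultimately have "is_path V E (a # b # ys)"
      using ab e is_path_Cons[of V E "b # ys" a] by simp
    moreover have "last (b # ys) = r" using p(2) ys by simp
    ultimately have "is_parent V E r a b" unfolding is_parent_def by blast
    then show ?thesis ..
  next
    case False
    then have "is_path V E (b # a # p)"
      using p ab e is_path_Cons[of V E "a # p" b] by (simp add: insert_commute)
    then have "is_parent V E r b a" using p(2) unfolding is_parent_def by blast
    then show ?thesis ..
  qed
  then show "e \<in> parent_edges V (parent_fun V E r)"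
  proof
    assume "is_parent V E r a b"
    then have "parent_fun V E r a = b" by (rule parent_fun_eq)
    then show ?thesis using ab parent_edgesI[of a V "parent_fun V E r"] by simp
  next
    assume "is_parent V E r b a"
    then have "parent_fun V E r b = a" by (rule parent_fun_eq)
    moreover have "e = {b, a}" using ab(1) by (simp add: insert_commute)
    ultimately show ?thesis using ab parent_edgesI[of b V "parent_fun V E r"] by simp
  qed
qed

end

section \<open>From a parent function with one root to its tree\<close>

text \<open>The number of steps to the root serves as a measure that drops along parents; it yields
  both repetition-free chains and the absence of cycles.\<close>

definition depth :: "('a \<Rightarrow> 'a) \<Rightarrow> 'a \<Rightarrow> nat" where
  "depth p x = (LEAST k. p ((p ^^ k) x) = (p ^^ k) x)"

lemma depth_less:
  assumes "root_of p x r" "p x \<noteq> x"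
  shows "depth p (p x) < depth p x"
proof -
  have "\<exists>k. p ((p ^^ k) x) = (p ^^ k) x"
    using assms(1)
  proof (induction rule: root_of.induct)
    case (root x)
    then show ?case by (intro exI[of _ 0]) simp
  next
    case (step x r)
    then obtain k where "p ((p ^^ k) (p x)) = (p ^^ k) (p x)" by blast
    then show ?case by (intro exI[of _ "Suc k"]) (simp add: funpow_swap1)
  qed
  then have k: "p ((p ^^ depth p x) x) = (p ^^ depth p x) x"
    unfolding depth_def by (rule LeastI_ex)
  then obtain j where j: "depth p x = Suc j" using assms(2) by (cases "depth p x") auto
  then have "p ((p ^^ j) (p x)) = (p ^^ j) (p x)" using k by (simp add: funpow_swap1)
  then have "depth p (p x) \<le> j" unfolding depth_def by (rule Least_le)
  then show ?thesis using j by simp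
qed

lemma is_cycle_neighbours:
  assumes c: "is_cycle V E c" and x: "x \<in> set c"
  obtains y z where "y \<in> set c" "z \<in> set c" "y \<noteq> z" "{x, y} \<in> E" "{x, z} \<in> E"
proof -
  obtain xs ys where s: "c = xs @ x # ys" using split_list[OF x] by blast
  have len: "length c \<ge> 3" and close: "{last c, hd c} \<in> E" and d: "distinct c"
    and succ: "successively (\<lambda>x y. {x, y} \<in> E) c"
    using c by (auto simp: is_cycle_def is_path_def)
  have left: "{x, last xs} \<in> E" if "xs \<noteq> []"
    using succ that by (simp add: s successively_append_iff insert_commute)
  have right: "{x, hd ys} \<in> E" if "ys \<noteq> []"
    using succ that by (simp add: s successively_append_iff successively_Cons)
  consider "xs = []" | "ys = []" | "xs \<noteq> []" "ys \<noteq> []" by blast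
  then show ?thesis
  proof cases
    case 1
    then obtain a b zs where ys: "ys = a # b # zs"
      using len s by (cases ys rule: remdups_adj.cases) auto
    \<comment> \<open>With \<open>x\<close> at the front, its neighbours are its successor
      \<open>a\<close> and, through the closing edge, the last vertex; length at least 3 keeps them
      apart.\<close>
    have "last (b # zs) \<noteq> a" using d s ys by (metis distinct.simps(2) distinct_append last_in_set list.distinct(1))
    then show ?thesis
      using that[of a "last (b # zs)"] right close 1 ys s by (auto simp: insert_commute)
  next
    case 2
    then obtain a b zs where xs: "xs = a # b # zs"
      using len s by (cases xs rule: remdups_adj.cases) auto
    have "last (b # zs) \<noteq> a" using d s xs by (metis append_Cons distinct.simps(2) last_in_set list.distinct(1) Un_iff set_append)
    then show ?thesis
      using that[of a "last (b # zs)"] left close 2 xs s by (auto simp: insert_commute)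
  next
    case 3
    then have "last xs \<in> set xs" "hd ys \<in> set ys" by auto
    moreover from this have "last xs \<noteq> hd ys" using d s by auto
    ultimately show ?thesis
      using that[of "last xs" "hd ys"] left right 3 s by simp
  qed
qed

context
  fixes V :: "'a set" and p r
  assumes p: "p \<in> forests V" and r: "roots p V = {r}"
begin

lemma root_of_unique_root: "x \<in> V \<Longrightarrow> root_of p x r"
  using forests_obtain_root[OF p, of x] r by (auto simp: tree_of_def)

text \<open>The chain of parents has strictly decreasing depth, so it repeats no vertex. The last
  conjunct records that its second vertex is the parent, as \<open>is_parent\<close>
  requires.\<close>

lemma parent_path:
  assumes "x \<in> V"
  shows "\<exists>q. is_path V (parent_edges V p) (x # q) \<and> last (x # q) = r \<and>
    (\<forall>y\<in>set q. depth p y < depth p x) \<and> (p x \<noteq> x \<longrightarrow> (\<exists>q'. q = p x # q'))"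
  using root_of_unique_root[OF assms] assms
proof (induction rule: root_of.induct)
  case (root x)
  then show ?case by (intro exI[of _ "[]"]) (simp add: is_path_def)
next
  case (step x s)
  have px: "p x \<in> V" using forests_in[OF p] step.prems .
  then obtain q where q: "is_path V (parent_edges V p) (p x # q)" "last (p x # q) = s"
    "\<forall>y\<in>set q. depth p y < depth p (p x)"
    using step.IH by blast
  have "depth p (p x) < depth p x"
    using depth_less root_of.step step.hyps by metis
  then have less: "\<forall>y\<in>set (p x # q). depth p y < depth p x" using q(3) by auto
  then have "x \<notin> set (p x # q)" by blast
  moreover have "{x, p x} \<in> parent_edges V p"
    using step by (intro parent_edgesI)
  ultimately have "is_path V (parent_edges V p) (x # p x # q)"
    using q(1) step.prems is_path_Cons[of V "parent_edges V p" "p x # q" x] by simp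
  then show ?case using q(2) less by (intro exI[of _ "p x # q"]) auto
qed

lemma is_tree_parent_edges: "is_tree V (parent_edges V p)"
  unfolding is_tree_def
proof (intro conjI ballI)
  show "V \<noteq> {}" using r by (auto simp: roots_def)
next
  fix e assume "e \<in> parent_edges V p"
  then obtain x where "x \<in> V" "p x \<noteq> x" "e = {x, p x}" by (auto simp: parent_edges_def)
  then show "e \<subseteq> V" "card e = 2" using forests_in[OF p] by auto
next
  fix u v assume uv: "u \<in> V" "v \<in> V"
  have "(x, r) \<in> (adj_rel V (parent_edges V p))\<^sup>*" if "x \<in> V" for x
    using parent_path[OF that] is_path_adj_rel_rtrancl by (metis list.sel(1))
  then have "(u, v) \<in> (adj_rel V (parent_edges V p))\<^sup>*"
    using uv sym_adj_rel_rtrancl rtrancl_trans by metis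
  then show "\<exists>q. is_path V (parent_edges V p) q \<and> hd q = u \<and> last q = v"
    using uv adj_rel_rtrancl_path by metis
next
  show "\<nexists>c. is_cycle V (parent_edges V p) c"
  proof
    assume "\<exists>c. is_cycle V (parent_edges V p) c"
    then obtain c where c: "is_cycle V (parent_edges V p) c" ..
    then have cV: "set c \<subseteq> V" "set c \<noteq> {}" by (auto simp: is_cycle_def is_path_def)
    \<comment> \<open>A vertex of greatest depth on a cycle would have two distinct neighbours
      there, yet its only neighbour that is not deeper is its parent.\<close>
    have "Max (depth p ` set c) \<in> depth p ` set c" using cV by (intro Max_in) auto
    then obtain x where "x \<in> set c" and x: "depth p x = Max (depth p ` set c)" by auto
    have max: "depth p y \<le> depth p x" if "y \<in> set c" for y
      unfolding x using that by (intro Max_ge) auto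
    obtain y z where yz: "y \<in> set c" "z \<in> set c" "y \<noteq> z"
      "{x, y} \<in> parent_edges V p" "{x, z} \<in> parent_edges V p"
      using is_cycle_neighbours[OF c \<open>x \<in> set c\<close>] .
    have "w = p x" if w: "w \<in> set c" "{x, w} \<in> parent_edges V p" for w
    proof (rule ccontr)
      assume "w \<noteq> p x"
      then have "p w = x" "p w \<noteq> w"
        using w(2) by (auto simp: parent_edges_def doubleton_eq_iff)
      moreover have "root_of p w r" using w cV root_of_unique_root by blast
      ultimately have "depth p x < depth p w" using depth_less by metis
      then show False using max[OF w(1)] by simp
    qed
    then show False using yz by metis
  qed
qed

lemma parent_fun_parent_edges: "parent_fun V (parent_edges V p) r = p"
proof
  fix v
  have rV: "r \<in> V" "p r = r" using r by (auto simp: roots_def)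
  consider "v \<notin> V" | "v = r" | "v \<in> V" "v \<noteq> r" by blast
  then show "parent_fun V (parent_edges V p) r v = p v"
  proof cases
    case 1
    then show ?thesis
      using p PiE_arb[of p V "\<lambda>_. V" v] by (simp add: forests_def parent_fun_def)
  next
    case 2
    then show ?thesis using rV by (simp add: parent_fun_def)
  next
    case 3
    then have "p v \<noteq> v" using r by (auto simp: roots_def)
    then have "is_parent V (parent_edges V p) r v (p v)"
      using parent_path[OF 3(1)] by (auto simp: is_parent_def)
    then show ?thesis using parent_fun_eq[OF is_tree_parent_edges rV(1)] by simp
  qed
qed

end

section \<open>The bijection between rooted trees and forests with one root\<close>

lemma descents_eq:
  assumes "is_tree V E" "r \<in> V"
  shows "descents V E r = descent_nodes (parent_fun V E r) V"
proof -
  have "(\<exists>u. is_parent V E r v u \<and> v < u) \<longleftrightarrow> v < parent_fun V E r v" if "v \<in> V" "v \<noteq> r" for v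
    using is_parent_iff[OF assms that] by simp
  then show ?thesis
    using parent_fun_root[OF assms] by (force simp: descents_def descent_nodes_def)
qed

lemma card_trees_with_descents:
  "card (trees_with_descents n i) = card {p \<in> forests {1..n}.
     (\<exists>r. roots p {1..n} = {r}) \<and> card (descent_nodes p {1..n}) = i}"
proof (rule bij_betw_same_card, rule bij_betw_byWitness)
  let ?V = "{1..n}"
  \<comment> \<open>The inverse map recovers the edges from the parent function and the root as its
    only fixed point.\<close>
  let ?f = "\<lambda>(E, r). parent_fun ?V E r" and ?g = "\<lambda>p. (parent_edges ?V p, the_elem (roots p ?V))"
  let ?F = "{p \<in> forests ?V. (\<exists>r. roots p ?V = {r}) \<and> card (descent_nodes p ?V) = i}"
  have T: "trees_with_descents n i =
    {(E, r). is_tree ?V E \<and> r \<in> ?V \<and> card (descents ?V E r) = i}"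
    by (auto simp: trees_with_descents_def rooted_trees_def)
  show "\<forall>t\<in>trees_with_descents n i. ?g (?f t) = t"
  proof
    fix t assume "t \<in> trees_with_descents n i"
    then obtain E r where "t = (E, r)" "is_tree ?V E" "r \<in> ?V" unfolding T by blast
    then show "?g (?f t) = t"
      using parent_edges_parent_fun[of ?V E r] roots_parent_fun[of ?V E r] by simp
  qed
  show "\<forall>p\<in>?F. ?f (?g p) = p"
    by (auto simp: parent_fun_parent_edges)
  show "?f ` trees_with_descents n i \<subseteq> ?F"
    unfolding T by (auto simp: parent_fun_forest roots_parent_fun descents_eq)
  show "?g ` ?F \<subseteq> trees_with_descents n i"
  proof
    fix t assume "t \<in> ?g ` ?F"
    then obtain p r where p: "p \<in> forests ?V" "roots p ?V = {r}" "card (descent_nodes p ?V) = i"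
      "t = (parent_edges ?V p, r)" by auto
    moreover have "r \<in> ?V" using p(2) by (auto simp: roots_def)
    ultimately show "t \<in> trees_with_descents n i"
      unfolding T using is_tree_parent_edges[OF p(1,2)] parent_fun_parent_edges[OF p(1,2)]
      by (simp add: descents_eq)
  qed
qed

theorem corollary2p4:
  fixes n i :: nat
  assumes "n \<ge> 1" and "i \<in> {0..n - 1}"
  shows "moebius (weighted_partition_poset n) (wp_bottom n) (wp_top n i) =
         (- 1) ^ (n - 1) * int (card (trees_with_descents n i))"
proof -
  let ?F = "{p \<in> forests {1..n}. (\<exists>r. roots p {1..n} = {r}) \<and> card (descent_nodes p {1..n}) = i}"
  have top: "wp_top n i \<in> weighted_partitions n"
    using assms by (auto simp: weighted_partitions_def wp_top_def partition_on_def)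
  have "{p. p \<in> forests {1..n} \<and> forest_partition {1..n} p = wp_top n i} = ?F"
    using forest_partition_eq_top_iff by blast
  then have "moebius (weighted_partition_poset n) (wp_bottom n) (wp_top n i) =
      (\<Sum>p\<in>?F. forest_sign {1..n} p)"
    using moebius_wp_bottom[OF top] by simp
  \<comment> \<open>No cancellation is left at the top: every forest counted here has a single root,
    hence \<open>n - 1\<close> non-root nodes and the same sign.\<close>
  also have "\<dots> = (\<Sum>p\<in>?F. (- 1) ^ (n - 1))"
  proof (intro sum.cong refl)
    fix p assume "p \<in> ?F"
    then obtain r where r: "roots p {1..n} = {r}" by blast
    have "{x \<in> {1..n}. p x \<noteq> x} = {1..n} - roots p {1..n}" unfolding roots_def by blast
    moreover have "r \<in> {1..n}" using r roots_subset[of p "{1..n}"] by simp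
    ultimately have "card {x \<in> {1..n}. p x \<noteq> x} = n - 1" using r by simp
    then show "forest_sign {1..n} p = (- 1) ^ (n - 1)" unfolding forest_sign_def by (rule arg_cong)
  qed
  also have "\<dots> = (- 1) ^ (n - 1) * int (card (trees_with_descents n i))"
    by (simp add: card_trees_with_descents)
  finally show ?thesis .
qed

end
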